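(* Let $T$ be a polygonal transformation in $\mathbb{P}^1$ admitting a scaling symmetry. Let $P=(p_1,\dots,p_n)$ be a closed $n$-gon and let $(c_i)$ be its cross-ratio coordinates, with deformation $c_i(t)$ under the scaling symmetry. Then its infinitesimal monodromy is $$M'(1)=\frac{n}{2}\mathrm{Id}+\begin{pmatrix} J & -K\\ I & -J\end{pmatrix}$$ (an equality in $\mathfrak{pgl}_2$), where $$I=\sum_{i=1}^n \frac{c_i'(1)}{c_i(1)}\frac{1}{p_i-p_{i+1}},\quad J=\frac{1}{2}\sum_{i=1}^n \frac{c_i'(1)}{c_i(1)}\frac{p_i+p_{i+1}}{p_i-p_{i+1}},\quad K=\sum_{i=1}^n \frac{c_i'(1)}{c_i(1)}\frac{p_ip_{i+1}}{p_i-p_{i+1}}.$$ Furthermore, its eigenvectors $(X,Y)^T$ satisfy the polynomial equation $$\chi_P(X,Y):= IX^2-2JXY+KY^2=0.$$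
   Context: Let $F$ be a field (of characteristic different from $2$), $\mathbb{P}^1=\mathbb{P}^1(F)$, $\mathrm{PGL}_2=\mathrm{GL}_2(F)/F^*$, $\mathbb{G}_m=F^*$ (as algebraic group). A (twisted) $n$-gon in $\mathbb{P}^1$ is $P=((p_i)_{i\in\mathbb{Z}},M)$ with $p_i\in\mathbb{P}^1$, monodromy $M\in\mathrm{PGL}_2$, $p_{i+n}=Mp_i$, such that $p_i,p_{i+1},p_{i+2}$ are pairwise distinct for every $i$. It is closed if $M=\mathrm{Id}$. Let $\tilde{\mathcal T}_n$ be the space of $n$-gons; $\mathrm{PGL}_2$ acts by $A\cdot P=((Ap_i),AMA^{-1})$, with quotient (moduli space) $\mathcal T_n$ and class $[P]$. A polygonal transformation is a birational map $T:\tilde{\mathcal T}_n\dashrightarrow\tilde{\mathcal T}_n$ commuting with this action; it induces a birational map of $\mathcal T_n$, also denoted $T$. The vertices are identified with their affine coordinates $p_i\in F$ (point $[p_i:1]$). The cross-ratio coordinates of $P$ are the $n$-periodic sequence $c_i=\frac{p_i-p_{i-1}}{p_i-p_{i+2}}\cdot\frac{p_{i+1}-p_{i+2}}{p_{i+1}-p_{i-1}}$, which determines $[P]$. A scaling symmetry is a non-trivial action $\rho:\mathbb{G}_m\times\mathcal T_n\to\mathcal T_n$, $(t,[P])\mapsto[P]_t$, of the algebraic group $\mathbb{G}_m$ (rational in $t$ and the $c_i$, undefined where the deformed polygon degenerates) commuting with $T$; $c_i(t)$ denotes the cross-ratio coordinates of $[P]_t$ and $'$ the derivative in $t$. A lift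 of the deformation is an algebraic family $(P_t)$ of $n$-gons with $P_1=P$, $[P_t]=[P]_t$; $M(t)$ is the monodromy of $P_t$. For $P$ closed, the infinitesimal monodromy is $M'(1)\in\mathfrak{pgl}_2=\mathfrak{gl}_2/F\cdot\mathrm{Id}$ (the tangent vector at $M(1)=\mathrm{Id}$), independent of the lift; thus matrices representing it are only defined up to adding a scalar matrix, which does not change eigenvectors. *)

theory Defs
  imports
    "HOL-Analysis.Determinants"
    "HOL-Library.Poly_Mapping"
    "HOL-Computational_Algebra.Polynomial"
    "HOL-Computational_Algebra.Fraction_Field"
begin

section \<open>The projective line, \<open>PGL\<^sub>2\<close> and its Lie algebra\<close>

definition proj_rel :: "'a::field^2 \<Rightarrow> 'a^2 \<Rightarrow> bool" where
  "proj_rel u v \<longleftrightarrow> u \<noteq> 0 \<and> v \<noteq> 0 \<and> (\<exists>k. k \<noteq> 0 \<and> u = k *s v)"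

lemma part_equivp_proj_rel: "part_equivp (proj_rel :: 'a::field^2 \<Rightarrow> _)"
proof (rule part_equivpI)
  show "\<exists>x. proj_rel x (x :: 'a^2)"
    by (rule exI[of _ "1"]) (auto simp: proj_rel_def intro!: exI[of _ 1])
  show "symp (proj_rel :: 'a^2 \<Rightarrow> _)"
  proof (rule sympI)
    fix u v :: "'a^2" assume "proj_rel u v"
    then obtain k where "u \<noteq> 0" "v \<noteq> 0" "k \<noteq> 0" "u = k *s v" by (auto simp: proj_rel_def)
    then show "proj_rel v u"
      by (auto simp: proj_rel_def vec_eq_iff intro!: exI[of _ "inverse k"])
  qed
  show "transp (proj_rel :: 'a^2 \<Rightarrow> _)"
  proof (rule transpI)
    fix u v w :: "'a^2" assume "proj_rel u v" "proj_rel v w"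
    then obtain k l where "u \<noteq> 0" "w \<noteq> 0" "k \<noteq> 0" "l \<noteq> 0" "u = k *s v" "v = l *s w"
      by (auto simp: proj_rel_def)
    then show "proj_rel u w"
      by (auto simp: proj_rel_def intro!: exI[of _ "k * l"])
  qed
qed

quotient_type (overloaded) 'a proj1 = "'a::field^2" / partial: proj_rel
  by (rule part_equivp_proj_rel)

definition pgl_rel :: "'a::field^2^2 \<Rightarrow> 'a^2^2 \<Rightarrow> bool" where
  "pgl_rel A B \<longleftrightarrow> invertible A \<and> invertible B \<and> (\<exists>k. k \<noteq> 0 \<and> A = mat k ** B)"

lemma mat_mult_entry: "(mat k ** A) $ i $ j = k * (A $ i $ j)" for A :: "'a::comm_semiring_1^'n^'n"
  by (simp add: matrix_matrix_mult_def mat_def if_distrib [of "\<lambda>x. x * _"] cong: if_cong)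

lemma mat_mult_commute: "A ** mat k = mat k ** A" for A :: "'a::comm_semiring_1^'n^'n"
  unfolding vec_eq_iff mat_mult_entry
  by (simp add: matrix_matrix_mult_def mat_def if_distrib [of "\<lambda>x. _ * x"] mult.commute cong: if_cong)

lemma mat_mult_mat: "mat k ** (mat l ** A) = mat (k * l) ** A" for A :: "'a::comm_semiring_1^'n^'n"
  unfolding vec_eq_iff mat_mult_entry by (simp add: mult.assoc)

lemma mat_mult_vec: "mat k *v v = k *s v" for v :: "'a::comm_semiring_1^'n"
  by (simp add: vec_eq_iff matrix_vector_mult_def mat_def if_distrib [of "\<lambda>x. x * _"] cong: if_cong)

lemma invertible_mult_vec_nz: "invertible A \<Longrightarrow> v \<noteq> 0 \<Longrightarrow> A *v v \<noteq> 0" for A :: "'a::field^'n^'n"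
  by (metis invertible_def matrix_vector_mul_assoc matrix_vector_mul_lid matrix_vector_mult_0_right)

lemma matrix_inv_props:
  assumes "invertible (A :: 'a::field^'n^'n)"
  shows "A ** matrix_inv A = mat 1" "matrix_inv A ** A = mat 1"
  using someI_ex[OF assms[unfolded invertible_def]] by (auto simp: matrix_inv_def)

lemma part_equivp_pgl_rel: "part_equivp (pgl_rel :: 'a::field^2^2 \<Rightarrow> _)"
proof (rule part_equivpI)
  show "\<exists>x. pgl_rel x (x :: 'a^2^2)"
    by (rule exI[of _ "mat 1"]) (auto simp: pgl_rel_def invertible_def intro!: exI[of _ 1] exI[of _ "mat 1"])
  show "symp (pgl_rel :: 'a^2^2 \<Rightarrow> _)"
  proof (rule sympI)
    fix u v :: "'a^2^2" assume "pgl_rel u v"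
    then obtain k where "invertible u" "invertible v" "k \<noteq> 0" "u = mat k ** v"
      by (auto simp: pgl_rel_def)
    then show "pgl_rel v u"
      by (auto simp: pgl_rel_def mat_mult_mat intro!: exI[of _ "inverse k"])
  qed
  show "transp (pgl_rel :: 'a^2^2 \<Rightarrow> _)"
  proof (rule transpI)
    fix u v w :: "'a^2^2" assume "pgl_rel u v" "pgl_rel v w"
    then obtain k l where "invertible u" "invertible w" "k \<noteq> 0" "l \<noteq> 0"
      "u = mat k ** v" "v = mat l ** w"
      by (auto simp: pgl_rel_def)
    then show "pgl_rel u w"
      by (auto simp: pgl_rel_def mat_mult_mat intro!: exI[of _ "k * l"])
  qed
qed

quotient_type (overloaded) 'a pgl2 = "'a::field^2^2" / partial: pgl_rel
  by (rule part_equivp_pgl_rel)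

definition lie_rel :: "'a::field^2^2 \<Rightarrow> 'a^2^2 \<Rightarrow> bool" where
  "lie_rel A B \<longleftrightarrow> (\<exists>k. A = B + mat k)"

quotient_type (overloaded) 'a lie_pgl2 = "'a::field^2^2" / lie_rel
proof (rule equivpI)
  show "reflp (lie_rel :: 'a^2^2 \<Rightarrow> _)"
    by (rule reflpI) (auto simp: lie_rel_def vec_eq_iff mat_def intro!: exI[of _ 0])
  show "symp (lie_rel :: 'a^2^2 \<Rightarrow> _)"
  proof (rule sympI)
    fix A B :: "'a^2^2" assume "lie_rel A B"
    then obtain k where "A = B + mat k" by (auto simp: lie_rel_def)
    then show "lie_rel B A"
      by (auto simp: lie_rel_def vec_eq_iff mat_def intro!: exI[of _ "- k"])
  qed
  show "transp (lie_rel :: 'a^2^2 \<Rightarrow> _)"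
  proof (rule transpI)
    fix A B C :: "'a^2^2" assume "lie_rel A B" "lie_rel B C"
    then obtain k l where "A = B + mat k" "B = C + mat l" by (auto simp: lie_rel_def)
    then show "lie_rel A C"
      by (auto simp: lie_rel_def vec_eq_iff mat_def intro!: exI[of _ "k + l"])
  qed
qed

lift_definition affine_pt :: "'a::field \<Rightarrow> 'a proj1" is "\<lambda>x. vector [x, 1]"
  by (auto simp: proj_rel_def vec_eq_iff forall_2 intro!: exI[of _ 1])

(* q = [x : y]; in particular (x, y) is not (0, 0) *)
lift_definition has_coords :: "'a::field proj1 \<Rightarrow> 'a \<Rightarrow> 'a \<Rightarrow> bool" is
  "\<lambda>u x y. proj_rel u (vector [x, y])"
proof -
  fix u v :: "'a^2" assume "proj_rel u v"
  then have "proj_rel u = proj_rel v"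
    by (metis part_equivp_proj_rel part_equivp_def)
  then show "(\<lambda>x y. proj_rel u (vector [x, y])) = (\<lambda>x y. proj_rel v (vector [x, y]))" by simp
qed

(* M is the class of A; in particular A is invertible *)
lift_definition has_matrix :: "'a::field pgl2 \<Rightarrow> 'a^2^2 \<Rightarrow> bool" is "\<lambda>M A. pgl_rel M A"
proof -
  fix u v :: "'a^2^2" assume "pgl_rel u v"
  then have "pgl_rel u = pgl_rel v"
    by (metis part_equivp_pgl_rel part_equivp_def)
  then show "(\<lambda>A. pgl_rel u A) = (\<lambda>A. pgl_rel v A)" by simp
qed

lift_definition pgl_id :: "'a::field pgl2" is "mat 1"
  by (auto simp: pgl_rel_def invertible_def intro!: exI[of _ 1] exI[of _ "mat 1"])

lift_definition pgl_mult :: "'a::field pgl2 \<Rightarrow> 'a pgl2 \<Rightarrow> 'a pgl2" is "(**)"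
proof -
  fix A A' B B' :: "'a^2^2" assume "pgl_rel A A'" "pgl_rel B B'"
  then obtain k l where *: "invertible A" "invertible A'" "invertible B" "invertible B'"
      "k \<noteq> 0" "l \<noteq> 0" "A = mat k ** A'" "B = mat l ** B'"
    by (auto simp: pgl_rel_def)
  have "A ** B = mat k ** (A' ** mat l) ** B'" using * by (simp add: matrix_mul_assoc)
  also have "\<dots> = mat (k * l) ** (A' ** B')"
    by (simp only: mat_mult_commute mat_mult_mat matrix_mul_assoc [symmetric])
  finally show "pgl_rel (A ** B) (A' ** B')"
    using * unfolding pgl_rel_def by (metis invertible_mult mult_eq_0_iff)
qed

lift_definition pgl_inv :: "'a::field pgl2 \<Rightarrow> 'a pgl2" is matrix_inv
proof -
  fix A B :: "'a^2^2" assume "pgl_rel A B"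
  then obtain k where *: "invertible A" "invertible B" "k \<noteq> 0" "A = mat k ** B"
    by (auto simp: pgl_rel_def)
  note iA = matrix_inv_props[OF *(1)] and iB = matrix_inv_props[OF *(2)]
  have "A ** (mat (inverse k) ** matrix_inv B) = mat (inverse k) ** (A ** matrix_inv B)"
    by (metis mat_mult_commute matrix_mul_assoc)
  also have "\<dots> = mat 1"
    using * iB by (simp add: matrix_mul_assoc [symmetric] mat_mult_mat mat_mult_mat [of _ _ "mat 1", simplified])
  finally have "matrix_inv A = mat (inverse k) ** matrix_inv B"
    by (metis iA(2) matrix_mul_assoc matrix_mul_lid matrix_mul_rid)
  moreover have "invertible (matrix_inv A)" "invertible (matrix_inv B)"
    using iA iB by (auto simp: invertible_def)
  ultimately show "pgl_rel (matrix_inv A) (matrix_inv B)"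
    using * by (auto simp: pgl_rel_def intro!: exI[of _ "inverse k"])
qed

lift_definition pgl_apply :: "'a::field pgl2 \<Rightarrow> 'a proj1 \<Rightarrow> 'a proj1" is "(*v)"
proof -
  fix A B :: "'a^2^2" and u v :: "'a^2" assume "pgl_rel A B" "proj_rel u v"
  then obtain k l where *: "invertible A" "invertible B" "k \<noteq> 0" "A = mat k ** B"
    "u \<noteq> 0" "v \<noteq> 0" "l \<noteq> 0" "u = l *s v"
    by (auto simp: pgl_rel_def proj_rel_def)
  have "A *v u = (mat k ** (B ** mat l)) *v v"
    using * by (simp add: matrix_vector_mul_assoc [symmetric] mat_mult_vec)
  also have "\<dots> = (k * l) *s (B *v v)"
    by (simp add: mat_mult_commute mat_mult_mat matrix_vector_mul_assoc [symmetric] mat_mult_vec)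
  finally show "proj_rel (A *v u) (B *v v)"
    using * by (auto simp: proj_rel_def invertible_mult_vec_nz intro!: exI[of _ "k * l"])
qed

lift_definition lie_class :: "'a::field^2^2 \<Rightarrow> 'a lie_pgl2" is "\<lambda>A. A" .

lift_definition lie_eigenvector :: "'a::field lie_pgl2 \<Rightarrow> 'a^2 \<Rightarrow> bool" is
  "\<lambda>A v. v \<noteq> 0 \<and> (\<exists>l. A *v v = l *s v)"
proof -
  fix A B :: "'a^2^2" assume "lie_rel A B"
  then obtain k where k: "A = B + mat k" by (auto simp: lie_rel_def)
  have "A *v v = l *s v \<longleftrightarrow> B *v v = (l - k) *s v" for l v
    by (auto simp: k matrix_vector_mult_add_rdistrib mat_mult_vec vec_eq_iff algebra_simps)
  moreover have "(\<exists>l. B *v v = (l - k) *s v) \<longleftrightarrow> (\<exists>l. B *v v = l *s v)" for v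
    by (metis add_diff_cancel_right')
  ultimately show "(\<lambda>v. v \<noteq> 0 \<and> (\<exists>l. A *v v = l *s v)) = (\<lambda>v. v \<noteq> 0 \<and> (\<exists>l. B *v v = l *s v))"
    by auto
qed

section \<open>Twisted polygons and cross-ratio coordinates\<close>

record (overloaded) 'a polygon =
  vertex :: "int \<Rightarrow> 'a proj1"
  monodromy :: "'a pgl2"

definition ngon :: "nat \<Rightarrow> 'a::field polygon \<Rightarrow> bool" where
  "ngon n P \<longleftrightarrow> n \<ge> 1 \<and>
     (\<forall>i. vertex P (i + int n) = pgl_apply (monodromy P) (vertex P i)) \<and>
     (\<forall>i. vertex P i \<noteq> vertex P (i + 1) \<and> vertex P (i + 1) \<noteq> vertex P (i + 2) \<and>
          vertex P i \<noteq> vertex P (i + 2))"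

definition closed_ngon :: "nat \<Rightarrow> 'a::field polygon \<Rightarrow> bool" where
  "closed_ngon n P \<longleftrightarrow> ngon n P \<and> monodromy P = pgl_id"

definition pgl_act :: "'a::field pgl2 \<Rightarrow> 'a polygon \<Rightarrow> 'a polygon" where
  "pgl_act A P = \<lparr>vertex = \<lambda>i. pgl_apply A (vertex P i),
                  monodromy = pgl_mult (pgl_mult A (monodromy P)) (pgl_inv A)\<rparr>"

(* The 2x2 determinant of homogeneous coordinates; for u = (x, 1), v = (y, 1) it is x - y. *)
definition bracket :: "'a::field^2 \<Rightarrow> 'a^2 \<Rightarrow> 'a" where
  "bracket u v = u $ 1 * v $ 2 - u $ 2 * v $ 1"

lemma bracket_scale: "bracket (k *s u) (l *s v) = k * l * bracket u v"
  by (simp add: bracket_def algebra_simps)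

(* In affine coordinates: ((b - a) / (b - d)) * ((c - d) / (c - a)). *)
lift_definition cross_ratio ::
    "'a::field proj1 \<Rightarrow> 'a proj1 \<Rightarrow> 'a proj1 \<Rightarrow> 'a proj1 \<Rightarrow> 'a" is
  "\<lambda>a b c d. (bracket b a / bracket b d) * (bracket c d / bracket c a)"
  by (auto simp: proj_rel_def bracket_scale divide_simps)

definition cr_coord :: "'a::field polygon \<Rightarrow> nat \<Rightarrow> 'a" where
  "cr_coord P i = (let j = int i in
     cross_ratio (vertex P (j - 1)) (vertex P j) (vertex P (j + 1)) (vertex P (j + 2)))"

section \<open>Rational functions\<close>

(* Polynomials, respectively rational functions, over 'a in indeterminates x_0, x_1, x_2, ... *)
type_synonym 'a mpoly = "(nat \<Rightarrow>\<^sub>0 nat) \<Rightarrow>\<^sub>0 'a"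
type_synonym 'a ratfun = "'a mpoly fract"

definition in_vars :: "nat set \<Rightarrow> 'a::zero mpoly \<Rightarrow> bool" where
  "in_vars V p \<longleftrightarrow> (\<forall>m \<in> Poly_Mapping.keys p. Poly_Mapping.keys m \<subseteq> V)"

definition ratvar :: "nat \<Rightarrow> 'a::field ratfun" where
  "ratvar i = Fract (Poly_Mapping.single (Poly_Mapping.single i 1) 1) 1"

definition ratconst :: "'a::field \<Rightarrow> 'a ratfun" where
  "ratconst a = Fract (Poly_Mapping.single 0 a) 1"

(* Evaluation in an extension field, coefficients being embedded by \<phi>. *)
definition mpoly_eval :: "('a::zero \<Rightarrow> 'k::field) \<Rightarrow> (nat \<Rightarrow> 'k) \<Rightarrow> 'a mpoly \<Rightarrow> 'k" where
  "mpoly_eval \<phi> x p =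
     (\<Sum>m \<in> Poly_Mapping.keys p. \<phi> (Poly_Mapping.lookup p m) *
        (\<Prod>i \<in> Poly_Mapping.keys m. x i ^ Poly_Mapping.lookup m i))"

(* f, as an element of F(x_i | i in V), is regular at the point x and has the value v there. *)
definition rat_val ::
    "('a::field \<Rightarrow> 'k::field) \<Rightarrow> nat set \<Rightarrow> 'a ratfun \<Rightarrow> (nat \<Rightarrow> 'k) \<Rightarrow> 'k \<Rightarrow> bool" where
  "rat_val \<phi> V f x v \<longleftrightarrow> (\<exists>N D. in_vars V N \<and> in_vars V D \<and> D \<noteq> 0 \<and> f = Fract N D \<and>
     mpoly_eval \<phi> x D \<noteq> 0 \<and> v = mpoly_eval \<phi> x N / mpoly_eval \<phi> x D)"

(* The same for a rational function q with values in the projective line,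
   that is, for a point q of the projective line over F(x_i | i in V). *)
definition proj_val ::
    "('a::field \<Rightarrow> 'k::field) \<Rightarrow> nat set \<Rightarrow> 'a ratfun proj1 \<Rightarrow> (nat \<Rightarrow> 'k) \<Rightarrow> 'k proj1 \<Rightarrow> bool" where
  "proj_val \<phi> V q x v \<longleftrightarrow> (\<exists>N D. in_vars V N \<and> in_vars V D \<and>
     has_coords q (Fract N 1) (Fract D 1) \<and>
     has_coords v (mpoly_eval \<phi> x N) (mpoly_eval \<phi> x D))"

text \<open>
  The ground field \<open>F\<close> may be finite, so rational maps and identities between them cannot be
  tested on \<open>F\<close>-points.  They are tested on points over the field
  \<open>F(x\<^sub>0, x\<^sub>1, x\<^sub>2, \<dots>)\<close>, which contains \<open>F\<close> and also the generic points of all the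
  varieties in question (all of them are rational over \<open>F\<close>).
\<close>

section \<open>Polygonal transformations\<close>

text \<open>
  An \<open>n\<close>-gon is determined by the vertices \<open>p\<^sub>1, \<dots>, p\<^sub>n\<^sub>+\<^sub>3\<close>: the monodromy is the unique
  projective transformation taking \<open>p\<^sub>1, p\<^sub>2, p\<^sub>3\<close> to \<open>p\<^sub>n\<^sub>+\<^sub>1, p\<^sub>n\<^sub>+\<^sub>2, p\<^sub>n\<^sub>+\<^sub>3\<close>.
  Conversely any \<open>n + 3\<close> points such that three consecutive ones are always distinct arise in
  this way.  So the affine coordinates of \<open>p\<^sub>1, \<dots>, p\<^sub>n\<^sub>+\<^sub>3\<close> are coordinates on a dense
  open subset of the space of \<open>n\<close>-gons, and a rational map \<open>T\<close> from this space to itself is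
  given by the vertices \<open>T 1, \<dots>, T (n + 3)\<close> of the image, which are points of the projective
  line over \<open>F(x\<^sub>1, \<dots>, x\<^sub>n\<^sub>+\<^sub>3)\<close>.  The predicate below says that \<open>Q\<close> is the value of
  this map at \<open>P\<close>; if the formulas for \<open>T\<close> do not yield an \<open>n\<close>-gon at \<open>P\<close>, then \<open>T\<close> is
  undefined at \<open>P\<close>.
\<close>

definition maps_to ::
    "nat \<Rightarrow> (nat \<Rightarrow> 'a::field ratfun proj1) \<Rightarrow> 'a ratfun polygon \<Rightarrow> 'a ratfun polygon \<Rightarrow> bool" where
  "maps_to n T P Q \<longleftrightarrow> ngon n P \<and> ngon n Q \<and>
     (\<exists>x. \<forall>i \<in> {1..n+3}. vertex P (int i) = affine_pt (x i) \<and>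
                         proj_val ratconst {1..n+3} (T i) x (vertex Q (int i)))"

definition generic_ngon :: "nat \<Rightarrow> 'a::field ratfun polygon \<Rightarrow> bool" where
  "generic_ngon n G \<longleftrightarrow> ngon n G \<and> (\<forall>i \<in> {1..n+3}. vertex G (int i) = affine_pt (ratvar i))"

(* Two rational maps inverse to each other, as is expressed at the generic point. *)
definition birational_ngon_map :: "nat \<Rightarrow> (nat \<Rightarrow> 'a::field ratfun proj1) \<Rightarrow> bool" where
  "birational_ngon_map n T \<longleftrightarrow> (\<exists>S G Q R. generic_ngon n G \<and>
     maps_to n T G Q \<and> maps_to n S Q G \<and> maps_to n S G R \<and> maps_to n T R G)"

definition polygonal_transformation :: "nat \<Rightarrow> (nat \<Rightarrow> 'a::field ratfun proj1) \<Rightarrow> bool" where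
  "polygonal_transformation n T \<longleftrightarrow> birational_ngon_map n T \<and>
     (\<forall>A P Q R. maps_to n T P Q \<longrightarrow> maps_to n T (pgl_act A P) R \<longrightarrow> R = pgl_act A Q)"

section \<open>Scaling symmetries\<close>

text \<open>
  The cross-ratio coordinates identify the moduli space of \<open>n\<close>-gons with \<open>(F\<^sup>*)\<^sup>n\<close>: none of the
  \<open>c\<^sub>i\<close> is \<open>0\<close> or \<open>\<infinity>\<close>, and given such a sequence, \<open>p\<^sub>i\<^sub>+\<^sub>2\<close> is
  determined by \<open>p\<^sub>i\<^sub>-\<^sub>1, p\<^sub>i, p\<^sub>i\<^sub>+\<^sub>1\<close>.  A point of the moduli space is a function on the indices
  \<open>1, \<dots>, n\<close> with nonzero values.  A rational map \<open>\<rho>\<close> from \<open>G\<^sub>m \<times> (moduli space)\<close> to the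
  moduli space is given by \<open>\<rho> 1, \<dots>, \<rho> n \<in> F(t, c\<^sub>1, \<dots>, c\<^sub>n)\<close>, where the indeterminate
  \<open>x\<^sub>0\<close> plays the role of \<open>t\<close> and \<open>x\<^sub>i\<close> that of \<open>c\<^sub>i\<close>.
\<close>

definition moduli_pt :: "nat \<Rightarrow> (nat \<Rightarrow> 'k::field) \<Rightarrow> bool" where
  "moduli_pt n c \<longleftrightarrow> (\<forall>i \<in> {1..n}. c i \<noteq> 0)"

definition same_moduli :: "nat \<Rightarrow> (nat \<Rightarrow> 'k::field) \<Rightarrow> (nat \<Rightarrow> 'k) \<Rightarrow> bool" where
  "same_moduli n c d \<longleftrightarrow> (\<forall>i \<in> {1..n}. c i = d i)"

(* The action \<rho> is defined at (t, c) and has the value d there. *)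
definition scales_to ::
    "('a::field \<Rightarrow> 'k::field) \<Rightarrow> nat \<Rightarrow> (nat \<Rightarrow> 'a ratfun) \<Rightarrow> 'k \<Rightarrow> (nat \<Rightarrow> 'k) \<Rightarrow> (nat \<Rightarrow> 'k) \<Rightarrow> bool" where
  "scales_to \<phi> n \<rho> t c d \<longleftrightarrow> t \<noteq> 0 \<and> moduli_pt n c \<and> moduli_pt n d \<and>
     (\<forall>i \<in> {1..n}. rat_val \<phi> {0..n} (\<rho> i) (\<lambda>j. if j = 0 then t else c j) (d i))"

(* Since the deformed polygon for t = 1 is the given one, the action is defined there. *)
definition gm_action :: "nat \<Rightarrow> (nat \<Rightarrow> 'a::field ratfun) \<Rightarrow> bool" where
  "gm_action n \<rho> \<longleftrightarrow>
     (\<forall>c. moduli_pt n c \<longrightarrow> scales_to ratconst n \<rho> 1 c c) \<and>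
     (\<forall>s t c d e f. scales_to ratconst n \<rho> t c d \<longrightarrow> scales_to ratconst n \<rho> s d e \<longrightarrow>
        scales_to ratconst n \<rho> (s * t) c f \<longrightarrow> same_moduli n e f)"

definition nontrivial_action :: "nat \<Rightarrow> (nat \<Rightarrow> 'a::field ratfun) \<Rightarrow> bool" where
  "nontrivial_action n \<rho> \<longleftrightarrow> (\<exists>t c d. scales_to ratconst n \<rho> t c d \<and> \<not> same_moduli n c d)"

(* If [P'] = [P]_t, then [T P'] = [T P]_t, wherever both sides are defined. *)
definition commutes_with ::
    "nat \<Rightarrow> (nat \<Rightarrow> 'a::field ratfun proj1) \<Rightarrow> (nat \<Rightarrow> 'a ratfun) \<Rightarrow> bool" where
  "commutes_with n T \<rho> \<longleftrightarrow> (\<forall>t P P' Q Q' d.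
     scales_to ratconst n \<rho> t (cr_coord P) (cr_coord P') \<longrightarrow>
     maps_to n T P Q \<longrightarrow> maps_to n T P' Q' \<longrightarrow>
     scales_to ratconst n \<rho> t (cr_coord Q) d \<longrightarrow> same_moduli n d (cr_coord Q'))"

definition scaling_symmetry ::
    "nat \<Rightarrow> (nat \<Rightarrow> 'a::field ratfun proj1) \<Rightarrow> (nat \<Rightarrow> 'a ratfun) \<Rightarrow> bool" where
  "scaling_symmetry n T \<rho> \<longleftrightarrow> gm_action n \<rho> \<and> nontrivial_action n \<rho> \<and> commutes_with n T \<rho>"

section \<open>Rational functions of one variable, lifts and the infinitesimal monodromy\<close>

definition regular_at :: "'a::field \<Rightarrow> 'a poly fract \<Rightarrow> bool" where
  "regular_at a f \<longleftrightarrow> (\<exists>N D. f = Fract N D \<and> poly D a \<noteq> 0)"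

definition val_at :: "'a::field \<Rightarrow> 'a poly fract \<Rightarrow> 'a" where
  "val_at a f = (THE v. \<exists>N D. f = Fract N D \<and> poly D a \<noteq> 0 \<and> v = poly N a / poly D a)"

definition deriv_at :: "'a::field \<Rightarrow> 'a poly fract \<Rightarrow> 'a" where
  "deriv_at a f = (THE v. \<exists>N D. f = Fract N D \<and> poly D a \<noteq> 0 \<and>
     v = (poly (pderiv N) a * poly D a - poly N a * poly (pderiv D) a) / (poly D a)\<^sup>2)"

definition tconst :: "'a::field \<Rightarrow> 'a poly fract" where
  "tconst a = Fract [:a:] 1"

definition tvar :: "'a::field poly fract" where
  "tvar = Fract [:0, 1:] 1"

(* c_i(t) as an element of F(t); the function is only determined at the indices 1, ..., n. *)
definition deformed_coord ::
    "nat \<Rightarrow> (nat \<Rightarrow> 'a::field ratfun) \<Rightarrow> 'a polygon \<Rightarrow> nat \<Rightarrow> 'a poly fract" where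
  "deformed_coord n \<rho> P i = (THE v. rat_val tconst {0..n} (\<rho> i)
     (\<lambda>j. if j = 0 then tvar else tconst (cr_coord P j)) v)"

definition proj_specializes :: "'a::field \<Rightarrow> 'a poly fract proj1 \<Rightarrow> 'a proj1 \<Rightarrow> bool" where
  "proj_specializes a q p \<longleftrightarrow> (\<exists>x y. regular_at a x \<and> regular_at a y \<and>
     has_coords q x y \<and> has_coords p (val_at a x) (val_at a y))"

definition regular_matrix_at :: "'a::field \<Rightarrow> 'a poly fract^2^2 \<Rightarrow> bool" where
  "regular_matrix_at a A \<longleftrightarrow> (\<forall>i j. regular_at a (A $ i $ j))"

definition pgl_specializes :: "'a::field \<Rightarrow> 'a poly fract pgl2 \<Rightarrow> 'a pgl2 \<Rightarrow> bool" where
  "pgl_specializes a M L \<longleftrightarrow> (\<exists>A. regular_matrix_at a A \<and> has_matrix M A \<and>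
     has_matrix L (\<chi> i j. val_at a (A $ i $ j)))"

(* An algebraic family of n-gons, with parameter t near 1, is an n-gon over F(t) that has a
   specialization at t = 1. *)
definition is_lift ::
    "nat \<Rightarrow> (nat \<Rightarrow> 'a::field ratfun) \<Rightarrow> 'a polygon \<Rightarrow> 'a poly fract polygon \<Rightarrow> bool" where
  "is_lift n \<rho> P Pt \<longleftrightarrow> ngon n Pt \<and>
     (\<forall>i. proj_specializes 1 (vertex Pt i) (vertex P i)) \<and>
     pgl_specializes 1 (monodromy Pt) (monodromy P) \<and>
     (\<forall>i \<in> {1..n}. cr_coord Pt i = deformed_coord n \<rho> P i)"

(* For M(1) = Id: the tangent vector is A'(1), where A(t) represents M(t) and A(1) = Id.
   Another such matrix is k(t) A(t) with k(1) = 1, and has derivative A'(1) + k'(1) Id. *)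
definition tangent_at_id :: "'a::field poly fract pgl2 \<Rightarrow> 'a lie_pgl2 \<Rightarrow> bool" where
  "tangent_at_id M X \<longleftrightarrow> (\<exists>A. regular_matrix_at 1 A \<and> has_matrix M A \<and>
     (\<chi> i j. val_at 1 (A $ i $ j)) = mat 1 \<and>
     X = lie_class (\<chi> i j. deriv_at 1 (A $ i $ j)))"

(* A definite description: that a lift exists and that M'(1) is the same for all lifts
   has to be proved before anything can be said about this value. *)
definition infinitesimal_monodromy ::
    "nat \<Rightarrow> (nat \<Rightarrow> 'a::field ratfun) \<Rightarrow> 'a polygon \<Rightarrow> 'a lie_pgl2" where
  "infinitesimal_monodromy n \<rho> P =
     (THE X. \<exists>Pt. is_lift n \<rho> P Pt \<and> tangent_at_id (monodromy Pt) X)"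

end

theory Submission
  imports Defs
begin

text \<open>
  Let \<open>x\<^sub>i(t)\<close> be the affine coordinates of the vertices of a lift, \<open>y\<^sub>i\<close> their derivatives at \<open>t = 1\<close>, and
  \<open>w\<^sub>i = c\<^sub>i'(1) / c\<^sub>i(1)\<close>.  Elements of \<open>pgl\<^sub>2\<close> are the same as quadratic vector fields on the line: a matrix
  with rows \<open>(\<alpha>, \<beta>)\<close> and \<open>(\<gamma>, \<delta>)\<close> moves the point \<open>x\<close> with velocity \<open>\<beta> + (\<alpha> - \<delta>) x - \<gamma> x\<^sup>2\<close>.  There is
  a unique such field \<open>\<eta>\<^sub>i\<close> with the velocities \<open>y\<^sub>i\<^sub>-\<^sub>1, y\<^sub>i, y\<^sub>i\<^sub>+\<^sub>1\<close> at \<open>p\<^sub>i\<^sub>-\<^sub>1, p\<^sub>i, p\<^sub>i\<^sub>+\<^sub>1\<close>.  The difference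
  \<open>\<eta>\<^sub>i\<^sub>+\<^sub>1 - \<eta>\<^sub>i\<close> vanishes at \<open>p\<^sub>i\<close> and \<open>p\<^sub>i\<^sub>+\<^sub>1\<close>.  It is therefore a multiple of \<open>(x - p\<^sub>i) (x - p\<^sub>i\<^sub>+\<^sub>1)\<close>, and since
  a field that moves all four points leaves the cross-ratio constant, the multiple is determined by
  \<open>w\<^sub>i\<close>: it is \<open>- w\<^sub>i / (p\<^sub>i - p\<^sub>i\<^sub>+\<^sub>1)\<close> (lemma \<open>cross_ratio_variation\<close>).  Summing over one period gives
  \<open>\<eta>\<^sub>n\<^sub>+\<^sub>1 - \<eta>\<^sub>1\<close>, which is the field of \<open>M'(1)\<close> because \<open>x\<^sub>i\<^sub>+\<^sub>n = M x\<^sub>i\<close>.  Its coefficients are \<open>- K\<close>, \<open>2 J\<close> and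
  \<open>- I\<close> (lemma \<open>monodromy_derivative\<close>).  Scalar matrices vanish in \<open>pgl\<^sub>2\<close>, so this is the formula
  for \<open>M'(1)\<close>, and eliminating the eigenvalue from the eigenvector equations gives the quadratic
  equation.

  The argument applies to every lift.  As the infinitesimal monodromy is a definite description, a
  lift must also be exhibited.  To deform one cross-ratio by the factor \<open>u\<^sub>i = c\<^sub>i(t) / c\<^sub>i(1)\<close>, one moves all
  later vertices by the projective map that fixes \<open>p\<^sub>i\<close> and \<open>p\<^sub>i\<^sub>+\<^sub>1\<close> with ratio of eigenvalues \<open>u\<^sub>i\<close>.
  The product of these maps over all vertices yields the lift, and over one period its monodromy
  (lemma \<open>closed_ngon_lift\<close>).  For this the functions \<open>c\<^sub>i(t)\<close> have to be regular at \<open>t = 1\<close> with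
  value \<open>c\<^sub>i\<close> there, which holds because \<open>1\<close> acts as the identity (lemma
  \<open>deformed_coord_at_1\<close>), and \<open>c\<^sub>i \<noteq> 0\<close> because consecutive vertices are distinct.
\<close>

section \<open>The local ring of \<open>F(t)\<close> at a point\<close>
lemma regular_at_Fract: "poly D a \<noteq> 0 \<Longrightarrow> regular_at a (Fract N D)"
  unfolding regular_at_def by blast

text \<open>
  The value and the derivative are given by definite descriptions over all ways of writing \<open>f\<close> as
  a fraction.  Two fractions for \<open>f\<close> satisfy \<open>N D' = N' D\<close>; this identity and its derivative,
  evaluated at \<open>a\<close>, show that the two formulas agree.
\<close>
lemma val_at_Fract:
  assumes "poly D a \<noteq> 0"
  shows "val_at a (Fract N D) = poly N a / poly D a"
  unfolding val_at_def
proof (rule the_equality)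
  fix v assume "\<exists>N' D'. Fract N D = Fract N' D' \<and> poly D' a \<noteq> 0 \<and> v = poly N' a / poly D' a"
  then obtain N' D' where *: "Fract N D = Fract N' D'" "poly D' a \<noteq> 0" "v = poly N' a / poly D' a"
    by blast
  with assms have "N * D' = N' * D" by (subst (asm) eq_fract) auto
  then have "poly N a * poly D' a = poly N' a * poly D a" by (metis poly_mult)
  with * assms show "v = poly N a / poly D a" by (simp add: frac_eq_eq)
qed (use assms in blast)

lemma deriv_at_Fract:
  assumes "poly D a \<noteq> 0"
  shows "deriv_at a (Fract N D) =
    (poly (pderiv N) a * poly D a - poly N a * poly (pderiv D) a) / (poly D a)\<^sup>2"
  unfolding deriv_at_def
proof (rule the_equality)
  fix v assume "\<exists>N' D'. Fract N D = Fract N' D' \<and> poly D' a \<noteq> 0 \<and>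
    v = (poly (pderiv N') a * poly D' a - poly N' a * poly (pderiv D') a) / (poly D' a)\<^sup>2"
  then obtain N' D' where *: "Fract N D = Fract N' D'" "poly D' a \<noteq> 0"
    "v = (poly (pderiv N') a * poly D' a - poly N' a * poly (pderiv D') a) / (poly D' a)\<^sup>2"
    by blast
  with assms have eq: "N * D' = N' * D" by (subst (asm) eq_fract) auto
  then have "poly (N * D') a = poly (N' * D) a" "poly (pderiv (N * D')) a = poly (pderiv (N' * D)) a"
    by simp_all
  then have "poly N a * poly D' a = poly N' a * poly D a"
    "poly (pderiv N) a * poly D' a + poly N a * poly (pderiv D') a =
     poly (pderiv N') a * poly D a + poly N' a * poly (pderiv D) a"
    by (simp_all add: pderiv_mult algebra_simps)
  then have "(poly (pderiv N') a * poly D' a - poly N' a * poly (pderiv D') a) * (poly D a)\<^sup>2 =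
    (poly (pderiv N) a * poly D a - poly N a * poly (pderiv D) a) * (poly D' a)\<^sup>2"
    by algebra
  with * assms show "v = (poly (pderiv N) a * poly D a - poly N a * poly (pderiv D) a) / (poly D a)\<^sup>2"
    by (simp add: frac_eq_eq)
qed (use assms in blast)

lemmas at_Fract = regular_at_Fract val_at_Fract deriv_at_Fract

lemma regular_atE:
  assumes "regular_at a f"
  obtains N D where "f = Fract N D" "poly D a \<noteq> 0" "D \<noteq> 0"
  using assms unfolding regular_at_def by force

lemma tconst_0 [simp]: "tconst 0 = 0" by (simp add: tconst_def Zero_fract_def)
lemma tconst_1 [simp]: "tconst 1 = 1"
  by (simp add: tconst_def One_fract_def pCons_one)

lemma at_tconst [simp]:
  "regular_at a (tconst c)" "val_at a (tconst c) = c" "deriv_at a (tconst c) = 0"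
  by (simp_all add: tconst_def at_Fract)

lemma at_tvar [simp]: "regular_at a tvar" "val_at a tvar = a"
  by (simp_all add: tvar_def at_Fract)

lemma at_0 [simp]: "regular_at a 0" "val_at a 0 = 0" "deriv_at a 0 = 0"
  using at_tconst[of a 0] by simp_all

lemma at_1 [simp]: "regular_at a 1" "val_at a 1 = 1" "deriv_at a 1 = 0"
  using at_tconst[of a 1] by simp_all

text \<open>
  As conditional rewrite rules, these laws let the simplifier differentiate an algebraic identity
  between functions regular at \<open>a\<close>.
\<close>
lemma at_add [simp]:
  assumes "regular_at a f" "regular_at a g"
  shows "regular_at a (f + g)" "val_at a (f + g) = val_at a f + val_at a g"
    "deriv_at a (f + g) = deriv_at a f + deriv_at a g"
proof -
  obtain N D where *: "f = Fract N D" "poly D a \<noteq> 0" "D \<noteq> 0" using regular_atE[OF assms(1)] .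
  obtain M E where **: "g = Fract M E" "poly E a \<noteq> 0" "E \<noteq> 0" using regular_atE[OF assms(2)] .
  show "regular_at a (f + g)" "val_at a (f + g) = val_at a f + val_at a g"
    "deriv_at a (f + g) = deriv_at a f + deriv_at a g"
    using * ** by (simp_all add: at_Fract pderiv_mult pderiv_add power2_eq_square field_simps)
qed

lemma at_mult [simp]:
  assumes "regular_at a f" "regular_at a g"
  shows "regular_at a (f * g)" "val_at a (f * g) = val_at a f * val_at a g"
    "deriv_at a (f * g) = deriv_at a f * val_at a g + val_at a f * deriv_at a g"
proof -
  obtain N D where *: "f = Fract N D" "poly D a \<noteq> 0" "D \<noteq> 0" using regular_atE[OF assms(1)] .
  obtain M E where **: "g = Fract M E" "poly E a \<noteq> 0" "E \<noteq> 0" using regular_atE[OF assms(2)] .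
  show "regular_at a (f * g)" "val_at a (f * g) = val_at a f * val_at a g"
    "deriv_at a (f * g) = deriv_at a f * val_at a g + val_at a f * deriv_at a g"
    using * ** by (simp_all add: at_Fract pderiv_mult power2_eq_square field_simps)
qed

lemma at_minus [simp]:
  assumes "regular_at a f"
  shows "regular_at a (- f)" "val_at a (- f) = - val_at a f" "deriv_at a (- f) = - deriv_at a f"
proof -
  obtain N D where *: "f = Fract N D" "poly D a \<noteq> 0" "D \<noteq> 0" using regular_atE[OF assms] .
  show "regular_at a (- f)" "val_at a (- f) = - val_at a f" "deriv_at a (- f) = - deriv_at a f"
    using * by (simp_all add: at_Fract pderiv_minus field_simps)
qed

lemma at_diff [simp]:
  assumes "regular_at a f" "regular_at a g"
  shows "regular_at a (f - g)" "val_at a (f - g) = val_at a f - val_at a g"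
    "deriv_at a (f - g) = deriv_at a f - deriv_at a g"
  using at_add[OF assms(1) at_minus(1)[OF assms(2)]] assms by simp_all

lemma at_divide [simp]:
  assumes "regular_at a f" "regular_at a g" "val_at a g \<noteq> 0"
  shows "regular_at a (f / g)" "val_at a (f / g) = val_at a f / val_at a g"
proof -
  obtain N D where *: "f = Fract N D" "poly D a \<noteq> 0" "D \<noteq> 0" using regular_atE[OF assms(1)] .
  obtain M E where **: "g = Fract M E" "poly E a \<noteq> 0" "E \<noteq> 0" using regular_atE[OF assms(2)] .
  have "poly M a \<noteq> 0" using ** assms(3) by (simp add: at_Fract)
  then show "regular_at a (f / g)" "val_at a (f / g) = val_at a f / val_at a g"
    using * ** by (simp_all add: at_Fract)
qed

lemma at_power [simp]:
  assumes "regular_at a f"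
  shows "regular_at a (f ^ k)" "val_at a (f ^ k) = val_at a f ^ k"
  using assms by (induction k) simp_all

lemma at_sum:
  assumes "\<And>i. i \<in> S \<Longrightarrow> regular_at a (f i)"
  shows "regular_at a (\<Sum>i\<in>S. f i)" "val_at a (\<Sum>i\<in>S. f i) = (\<Sum>i\<in>S. val_at a (f i))"
  using assms by (induction S rule: infinite_finite_induct) simp_all

lemma at_prod:
  assumes "\<And>i. i \<in> S \<Longrightarrow> regular_at a (f i)"
  shows "regular_at a (\<Prod>i\<in>S. f i)" "val_at a (\<Prod>i\<in>S. f i) = (\<Prod>i\<in>S. val_at a (f i))"
  using assms by (induction S rule: infinite_finite_induct) simp_all

section \<open>The deformed cross-ratio coordinates\<close>

definition mon_eval :: "(nat \<Rightarrow> 'k::field) \<Rightarrow> (nat \<Rightarrow>\<^sub>0 nat) \<Rightarrow> 'k" where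
  "mon_eval x m = (\<Prod>i \<in> Poly_Mapping.keys m. x i ^ Poly_Mapping.lookup m i)"

lemma mon_eval_superset:
  assumes "finite S" "Poly_Mapping.keys m \<subseteq> S"
  shows "mon_eval x m = (\<Prod>i\<in>S. x i ^ Poly_Mapping.lookup m i)"
  unfolding mon_eval_def
  by (rule prod.mono_neutral_left) (use assms in \<open>auto simp: in_keys_iff\<close>)

lemma mon_eval_add: "mon_eval x (m + m') = mon_eval x m * mon_eval x m'"
proof -
  let ?S = "Poly_Mapping.keys m \<union> Poly_Mapping.keys m'"
  have "Poly_Mapping.keys (m + m') \<subseteq> ?S" by (rule keys_add)
  then show ?thesis
    by (simp add: mon_eval_superset[of ?S] lookup_add power_add prod.distrib)
qed

text \<open>
  A point can lie in an extension field, so the coefficients are moved there by \<open>\<phi>\<close>.  That \<open>\<phi>\<close> is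
  additive and multiplicative makes evaluation a ring homomorphism, whence the value of a rational
  function is independent of the fraction that represents it.
\<close>
locale coefficient_hom =
  fixes \<phi> :: "'a::field \<Rightarrow> 'k::field"
  assumes hom_0: "\<phi> 0 = 0" and hom_add: "\<phi> (a + b) = \<phi> a + \<phi> b"
    and hom_mult: "\<phi> (a * b) = \<phi> a * \<phi> b"
begin

lemma eval_superset:
  assumes "finite S" "Poly_Mapping.keys p \<subseteq> S"
  shows "mpoly_eval \<phi> x p = (\<Sum>m\<in>S. \<phi> (Poly_Mapping.lookup p m) * mon_eval x m)"
  unfolding mpoly_eval_def mon_eval_def
  by (rule sum.mono_neutral_left) (use assms in \<open>auto simp: in_keys_iff hom_0\<close>)

lemma eval_0 [simp]: "mpoly_eval \<phi> x 0 = 0"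
  by (simp add: mpoly_eval_def)

lemma eval_add: "mpoly_eval \<phi> x (p + q) = mpoly_eval \<phi> x p + mpoly_eval \<phi> x q"
proof -
  let ?S = "Poly_Mapping.keys p \<union> Poly_Mapping.keys q"
  have "Poly_Mapping.keys (p + q) \<subseteq> ?S" by (rule keys_add)
  then show ?thesis
    by (simp add: eval_superset[of ?S] lookup_add hom_add ring_distribs sum.distrib)
qed

lemma eval_sum: "mpoly_eval \<phi> x (\<Sum>i\<in>S. f i) = (\<Sum>i\<in>S. mpoly_eval \<phi> x (f i))"
  by (induction S rule: infinite_finite_induct) (simp_all add: eval_add)

lemma eval_single: "mpoly_eval \<phi> x (Poly_Mapping.single m a) = \<phi> a * mon_eval x m"
  by (subst eval_superset[of "{m}"]) auto

lemma eval_mult: "mpoly_eval \<phi> x (p * q) = mpoly_eval \<phi> x p * mpoly_eval \<phi> x q"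
proof -
  have expand: "r = (\<Sum>m\<in>Poly_Mapping.keys r. Poly_Mapping.single m (Poly_Mapping.lookup r m))"
    for r :: "'a mpoly"
    by (rule poly_mapping_eqI) (simp add: lookup_sum lookup_single when_def in_keys_iff)
  have "mpoly_eval \<phi> x (p * q) = (\<Sum>m\<in>Poly_Mapping.keys p. \<Sum>m'\<in>Poly_Mapping.keys q.
      \<phi> (Poly_Mapping.lookup p m * Poly_Mapping.lookup q m') * mon_eval x (m + m'))"
    by (subst expand[of p], subst expand[of q])
      (simp add: sum_product mult_single eval_sum eval_single)
  also have "\<dots> = mpoly_eval \<phi> x p * mpoly_eval \<phi> x q"
    by (simp add: mpoly_eval_def sum_product hom_mult mon_eval_add mult_ac flip: mon_eval_def)
  finally show ?thesis .
qed

lemma rat_val_unique: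
  assumes "rat_val \<phi> V f x v" "rat_val \<phi> V' f x v'"
  shows "v = v'"
proof -
  obtain N D where 1: "D \<noteq> 0" "f = Fract N D" "mpoly_eval \<phi> x D \<noteq> 0"
    "v = mpoly_eval \<phi> x N / mpoly_eval \<phi> x D"
    using assms(1) unfolding rat_val_def by blast
  obtain N' D' where 2: "D' \<noteq> 0" "f = Fract N' D'" "mpoly_eval \<phi> x D' \<noteq> 0"
    "v' = mpoly_eval \<phi> x N' / mpoly_eval \<phi> x D'"
    using assms(2) unfolding rat_val_def by blast
  have "N * D' = N' * D" using 1 2 by (simp add: eq_fract)
  then show ?thesis using 1 2 by (simp add: frac_eq_eq flip: eval_mult)
qed

end

interpretation tconst: coefficient_hom tconst
  by unfold_locales (simp_all, simp_all add: tconst_def mult.commute)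

lemma ratconst_hom [simp]: "ratconst 0 = 0" "ratconst 1 = 1" "ratconst (a + b) = ratconst a + ratconst b"
  "ratconst (a * b) = ratconst a * ratconst b"
  by (simp_all add: ratconst_def Zero_fract_def One_fract_def single_add mult_single)

lemma ratconst_inj [simp]: "ratconst a = ratconst b \<longleftrightarrow> a = b"
  by (simp add: ratconst_def eq_fract inj_eq)

lemma ratconst_eq_0_iff [simp]: "ratconst a = 0 \<longleftrightarrow> a = 0"
  using ratconst_inj[of a 0] by (simp del: ratconst_inj)

lemma ratconst_sum: "ratconst (\<Sum>i\<in>S. f i) = (\<Sum>i\<in>S. ratconst (f i))"
  by (induction S rule: infinite_finite_induct) simp_all

lemma ratconst_prod: "ratconst (\<Prod>i\<in>S. f i) = (\<Prod>i\<in>S. ratconst (f i))"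
  by (induction S rule: infinite_finite_induct) simp_all

lemma ratconst_power: "ratconst (a ^ k) = ratconst a ^ k"
  by (induction k) simp_all

lemma mpoly_eval_ratconst:
  "mpoly_eval ratconst (\<lambda>j. ratconst (c j)) p = ratconst (mpoly_eval (\<lambda>a. a) c p)"
  by (simp add: mpoly_eval_def ratconst_sum ratconst_prod ratconst_power)

text \<open>
  Specialization at \<open>t = a\<close> commutes with evaluation, since regular functions form a ring on which
  taking the value at \<open>a\<close> is a homomorphism.
\<close>
lemma mpoly_eval_at:
  assumes "\<And>j. regular_at a (x j)"
  shows "regular_at a (mpoly_eval tconst x p)"
    "val_at a (mpoly_eval tconst x p) = mpoly_eval (\<lambda>a. a) (\<lambda>j. val_at a (x j)) p"
  using assms by (simp_all add: mpoly_eval_def at_sum at_prod)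

text \<open>
  At \<open>t = 1\<close> the action is the identity.  Applied to the constant point \<open>c\<close>, this yields a fraction
  \<open>N / D\<close> for \<open>\<rho> i\<close> with \<open>D (1, c) \<noteq> 0\<close> and \<open>N (1, c) / D (1, c) = c\<^sub>i\<close>.  Then \<open>D (t, c)\<close> cannot vanish
  identically in \<open>t\<close>, so the same fraction defines \<open>c\<^sub>i(t)\<close> and shows that it is regular at \<open>1\<close>.
\<close>
lemma deformed_coord_at_1:
  fixes P :: "'a::field polygon"
  assumes gm: "gm_action n \<rho>" and nz: "\<And>j. j \<in> {1..n} \<Longrightarrow> cr_coord P j \<noteq> 0" and i: "i \<in> {1..n}"
  shows "regular_at 1 (deformed_coord n \<rho> P i)" "val_at 1 (deformed_coord n \<rho> P i) = cr_coord P i"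
proof -
  define y where "y = (\<lambda>j. if j = 0 then 1 else cr_coord P j)"
  define x where "x = (\<lambda>j. if j = 0 then tvar else tconst (cr_coord P j))"
  have reg: "regular_at 1 (x j)" and val: "val_at 1 (x j) = y j" for j
    by (simp_all add: x_def y_def)
  have "moduli_pt n (\<lambda>j. ratconst (cr_coord P j))"
    using nz by (simp add: moduli_pt_def)
  then have "scales_to ratconst n \<rho> 1 (\<lambda>j. ratconst (cr_coord P j)) (\<lambda>j. ratconst (cr_coord P j))"
    using gm unfolding gm_action_def by blast
  moreover have "(\<lambda>j. if j = 0 then 1 else ratconst (cr_coord P j)) = (\<lambda>j. ratconst (y j))"
    by (auto simp: y_def)
  ultimately have "rat_val ratconst {0..n} (\<rho> i) (\<lambda>j. ratconst (y j)) (ratconst (cr_coord P i))"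
    using i unfolding scales_to_def by simp
  then obtain N D where ND: "in_vars {0..n} N" "in_vars {0..n} D" "D \<noteq> 0" "\<rho> i = Fract N D"
    and D1: "mpoly_eval ratconst (\<lambda>j. ratconst (y j)) D \<noteq> 0"
    and c: "ratconst (cr_coord P i) =
      mpoly_eval ratconst (\<lambda>j. ratconst (y j)) N / mpoly_eval ratconst (\<lambda>j. ratconst (y j)) D"
    unfolding rat_val_def by blast
  let ?e = "mpoly_eval (\<lambda>a. a) y"
  have D2: "?e D \<noteq> 0" using D1 unfolding mpoly_eval_ratconst using ratconst_hom(1) by metis
  have "ratconst (cr_coord P i * ?e D) = ratconst (?e N)"
    using c D1 by (simp add: mpoly_eval_ratconst)
  then have c2: "cr_coord P i = ?e N / ?e D" using D2 by (simp only: ratconst_inj) (simp add: field_simps)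
  note N' = mpoly_eval_at[of 1 x N, OF reg, unfolded val]
  note D' = mpoly_eval_at[of 1 x D, OF reg, unfolded val]
  have nz: "mpoly_eval tconst x D \<noteq> 0" using D'(2) D2 by auto
  have rv: "rat_val tconst {0..n} (\<rho> i) x (mpoly_eval tconst x N / mpoly_eval tconst x D)"
    unfolding rat_val_def using ND nz by blast
  then have "deformed_coord n \<rho> P i = mpoly_eval tconst x N / mpoly_eval tconst x D"
    unfolding deformed_coord_def x_def[symmetric]
    by (rule the_equality) (rule tconst.rat_val_unique[OF _ rv])
  then show "regular_at 1 (deformed_coord n \<rho> P i)" "val_at 1 (deformed_coord n \<rho> P i) = cr_coord P i"
    using N' D' D2 c2 by simp_all
qed

section \<open>Points and maps of the projective line in coordinates\<close>
lemma proj_rel_refl: "v \<noteq> 0 \<Longrightarrow> proj_rel v v"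
  by (auto simp: proj_rel_def intro!: exI[of _ 1])

text \<open>
  In dimension two, proportionality of nonzero vectors is the vanishing of one determinant.  This
  turns equations between points into polynomial equations.
\<close>
lemma abs_proj1_eq_iff:
  assumes "u \<noteq> 0" "v \<noteq> 0"
  shows "abs_proj1 u = abs_proj1 v \<longleftrightarrow> bracket u v = 0"
proof -
  have "abs_proj1 u = abs_proj1 v \<longleftrightarrow> proj_rel u v"
    using Quotient3_rel[OF Quotient3_proj1] proj_rel_refl assms by blast
  also have "\<dots> \<longleftrightarrow> bracket u v = 0"
  proof
    assume "proj_rel u v"
    then show "bracket u v = 0" by (auto simp: proj_rel_def bracket_def)
  next
    assume br: "bracket u v = 0"
    obtain k where "u = k *s v"
    proof (cases "v $ 1 = 0")
      case True
      with assms br have "u $ 1 = 0" "v $ 2 \<noteq> 0" by (auto simp: bracket_def vec_eq_iff forall_2)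
      with True show ?thesis
        by (intro that[of "u $ 2 / v $ 2"]) (simp add: vec_eq_iff forall_2)
    next
      case False
      with br show ?thesis
        by (intro that[of "u $ 1 / v $ 1"]) (simp add: bracket_def vec_eq_iff forall_2 field_simps)
    qed
    with assms show "proj_rel u v" by (auto simp: proj_rel_def)
  qed
  finally show ?thesis .
qed

lemma pgl_rel_refl: "invertible A \<Longrightarrow> pgl_rel A A"
  by (auto simp: pgl_rel_def intro!: exI[of _ 1])

lemma abs_proj1_scale: "v \<noteq> 0 \<Longrightarrow> k \<noteq> 0 \<Longrightarrow> abs_proj1 (k *s v) = abs_proj1 v"
  by (subst abs_proj1_eq_iff) (auto simp: bracket_def)

definition affine_vec :: "'a::field \<Rightarrow> 'a^2" where
  "affine_vec x = vector [x, 1]"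

lemma affine_vec_nth [simp]: "affine_vec x $ 1 = x" "affine_vec x $ 2 = 1"
  by (simp_all add: affine_vec_def)

lemma affine_vec_nonzero [simp]: "affine_vec x \<noteq> 0"
  by (auto simp: vec_eq_iff forall_2)

lemma affine_pt_abs: "affine_pt x = abs_proj1 (affine_vec x)"
  by (simp add: affine_pt.abs_eq affine_vec_def)

lemma affine_pt_inject [simp]: "affine_pt x = affine_pt y \<longleftrightarrow> x = y"
  by (simp add: affine_pt_abs abs_proj1_eq_iff bracket_def)

lemma has_coords_iff: "has_coords q x y \<longleftrightarrow> vector [x, y] \<noteq> (0 :: 'a::field^2) \<and> q = abs_proj1 (vector [x, y])"
proof (induction q rule: proj1.abs_induct)
  case (1 u)
  then have "u \<noteq> 0" by (simp add: proj_rel_def)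
  have "has_coords (abs_proj1 u) x y \<longleftrightarrow> proj_rel u (vector [x, y])"
    using 1 by (simp add: has_coords.abs_eq)
  also have "\<dots> \<longleftrightarrow> vector [x, y] \<noteq> (0 :: 'a^2) \<and> abs_proj1 u = abs_proj1 (vector [x, y])"
    using Quotient3_rel[OF Quotient3_proj1] proj_rel_refl[OF \<open>u \<noteq> 0\<close>] proj_rel_refl
    by (metis proj_rel_def)
  finally show ?case .
qed

lemma has_matrix_iff: "has_matrix M A \<longleftrightarrow> invertible A \<and> M = abs_pgl2 A"
proof (induction M rule: pgl2.abs_induct)
  case (1 B)
  have "has_matrix (abs_pgl2 B) A \<longleftrightarrow> pgl_rel B A"
    using 1 by (simp add: has_matrix.abs_eq)
  also have "\<dots> \<longleftrightarrow> invertible A \<and> abs_pgl2 B = abs_pgl2 A"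
    using Quotient3_rel[OF Quotient3_pgl2] 1 pgl_rel_refl by (metis pgl_rel_def)
  finally show ?case .
qed

lemma pgl_apply_abs:
  "invertible A \<Longrightarrow> v \<noteq> 0 \<Longrightarrow> pgl_apply (abs_pgl2 A) (abs_proj1 v) = abs_proj1 (A *v v)"
  by (simp add: pgl_apply.abs_eq pgl_rel_refl proj_rel_refl)

lemma pgl_apply_id [simp]: "pgl_apply pgl_id q = q"
proof (induction q rule: proj1.abs_induct)
  case (1 u)
  then have "u \<noteq> 0" by (simp add: proj_rel_def)
  moreover have "invertible (mat 1 :: 'a^2^2)" by (auto simp: invertible_def intro!: exI[of _ "mat 1"])
  ultimately show ?case by (simp add: pgl_id.abs_eq pgl_apply_abs)
qed

lemma pgl_apply_affine:
  assumes "has_matrix M A" "pgl_apply M (affine_pt x) = affine_pt y"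
  shows "y * (A $ 2 $ 1 * x + A $ 2 $ 2) = A $ 1 $ 1 * x + A $ 1 $ 2"
proof -
  have A: "invertible A" "M = abs_pgl2 A" using assms(1) by (simp_all add: has_matrix_iff)
  then have "abs_proj1 (A *v affine_vec x) = abs_proj1 (affine_vec y)"
    using assms(2) by (simp add: affine_pt_abs pgl_apply_abs)
  then show ?thesis
    using A by (simp add: abs_proj1_eq_iff invertible_mult_vec_nz)
      (simp add: bracket_def matrix_vector_mult_def sum_2 algebra_simps)
qed

lemma cross_ratio_abs:
  assumes "a \<noteq> 0" "b \<noteq> 0" "c \<noteq> 0" "d \<noteq> 0"
  shows "cross_ratio (abs_proj1 a) (abs_proj1 b) (abs_proj1 c) (abs_proj1 d) =
    (bracket b a / bracket b d) * (bracket c d / bracket c a)"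
  using assms by (simp add: cross_ratio.abs_eq proj_rel_refl)

lemma cross_ratio_affine:
  "cross_ratio (affine_pt a) (affine_pt b) (affine_pt c) (affine_pt d) =
    ((b - a) / (b - d)) * ((c - d) / (c - a))"
  by (simp add: affine_pt_abs cross_ratio_abs bracket_def)

lemma bracket_matrix: "bracket (A *v u) (A *v v) = det A * bracket u v"
  by (simp add: bracket_def matrix_vector_mult_def sum_2 det_2 algebra_simps)

text \<open>
  A point specializing to a finite point has homogeneous coordinates whose second entry is a unit
  of the local ring.  Dividing by it gives an affine coordinate that is regular.
\<close>
lemma proj_specializes_affine:
  assumes "proj_specializes a q (affine_pt x)"
  obtains f where "q = affine_pt f" "regular_at a f" "val_at a f = x"
proof -
  obtain y z where reg: "regular_at a y" "regular_at a z"
    and q: "has_coords q y z" and x: "has_coords (affine_pt x) (val_at a y) (val_at a z)"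
    using assms unfolding proj_specializes_def by blast
  have x2: "bracket (affine_vec x) (vector [val_at a y, val_at a z]) = 0"
    and nz: "val_at a y \<noteq> 0 \<or> val_at a z \<noteq> 0"
    using x unfolding has_coords_iff affine_pt_abs 
    by (auto simp: abs_proj1_eq_iff) (auto simp: vec_eq_iff forall_2)
  then have val: "val_at a y = x * val_at a z" "val_at a z \<noteq> 0"
    by (auto simp: bracket_def)
  then have "z \<noteq> 0" by auto
  then have "vector [y, z] = z *s affine_vec (y / z)" by (simp add: vec_eq_iff forall_2)
  then have "q = affine_pt (y / z)"
    using q \<open>z \<noteq> 0\<close> unfolding has_coords_iff affine_pt_abs by (simp add: abs_proj1_scale)
  then show thesis by (rule that) (use reg val in simp_all)
qed

section \<open>Projective maps with two fixed points\<close>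

text \<open>
  The linear map with eigenvalue \<open>u\<close> at the point \<open>x\<close> and eigenvalue \<open>1\<close> at the point \<open>y\<close>, written as
  \<open>1 + (u - 1) E\<close>, where \<open>E\<close> is the projector onto \<open>(x, 1)\<close> along \<open>(y, 1)\<close>.  In this form it visibly
  tends to the identity as \<open>u\<close> tends to \<open>1\<close>.
\<close>
definition dilation :: "'a::field \<Rightarrow> 'a \<Rightarrow> 'a \<Rightarrow> 'a^2^2" where
  "dilation u x y = mat 1 + (\<chi> i j. (u - 1) / (x - y) * (affine_vec x $ i * vector [1, - y] $ j))"

lemma dilation_nth:
  "dilation u x y $ 1 $ 1 = 1 + (u - 1) / (x - y) * x"
  "dilation u x y $ 1 $ 2 = - ((u - 1) / (x - y) * (x * y))"
  "dilation u x y $ 2 $ 1 = (u - 1) / (x - y)"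
  "dilation u x y $ 2 $ 2 = 1 - (u - 1) / (x - y) * y"
  by (simp_all add: dilation_def mat_def)

lemma dilation_fst:
  assumes "x \<noteq> y"
  shows "dilation u x y *v affine_vec x = u *s affine_vec x"
proof -
  define s where "s = (u - 1) / (x - y)"
  have "u = 1 + s * (x - y)" using assms by (simp add: s_def)
  then show ?thesis
    by (simp add: vec_eq_iff forall_2 matrix_vector_mult_def sum_2 dilation_nth flip: s_def)
      (simp add: algebra_simps)
qed

lemma dilation_snd: "dilation u x y *v affine_vec y = affine_vec y"
proof -
  define s where "s = (u - 1) / (x - y)"
  show ?thesis
    by (simp add: vec_eq_iff forall_2 matrix_vector_mult_def sum_2 dilation_nth flip: s_def)
      (simp add: algebra_simps)
qed

lemma det_dilation: "x \<noteq> y \<Longrightarrow> det (dilation u x y) = u"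
  by (simp add: det_2 dilation_nth divide_simps) (simp add: algebra_simps)

lemma dilation_inverse: 
  assumes "x \<noteq> y" "u \<noteq> 0"
  shows "dilation u x y ** dilation (inverse u) x y = mat 1"
proof -
  have xy: "x - y \<noteq> 0" using assms by simp
  show ?thesis using xy assms(2)
    by (simp add: vec_eq_iff forall_2 matrix_matrix_mult_def sum_2 dilation_nth mat_def divide_simps)
      (simp add: algebra_simps)
qed

text \<open>
  This is how a single cross-ratio is deformed: moving the fourth point by a map that fixes the
  second and third multiplies the cross-ratio by the ratio of the eigenvalues there.
\<close>
lemma cross_ratio_dilation:
  assumes "x \<noteq> y" "u \<noteq> 0"
  shows "cross_ratio (affine_pt a) (affine_pt x) (affine_pt y) (abs_proj1 (dilation u x y *v affine_vec d)) =
    u * cross_ratio (affine_pt a) (affine_pt x) (affine_pt y) (affine_pt d)"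
proof -
  have "invertible (dilation u x y)" using assms by (simp add: invertible_det_nz det_dilation)
  then have nz: "dilation u x y *v affine_vec d \<noteq> 0" by (simp add: invertible_mult_vec_nz)
  have "bracket (affine_vec x) (dilation u x y *v affine_vec d) = bracket (affine_vec x) (affine_vec d)"
    using assms by (simp add: bracket_def matrix_vector_mult_def sum_2 dilation_nth divide_simps)
      (simp add: algebra_simps)
  moreover have "bracket (affine_vec y) (dilation u x y *v affine_vec d) = u * bracket (affine_vec y) (affine_vec d)"
    using assms by (simp add: bracket_def matrix_vector_mult_def sum_2 dilation_nth divide_simps)
      (simp add: algebra_simps)
  ultimately show ?thesis using nz by (simp add: affine_pt_abs cross_ratio_abs)
qed

lemma cross_ratio_matrix:
  assumes "invertible A" "a \<noteq> 0" "b \<noteq> 0" "c \<noteq> 0" "d \<noteq> 0"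
  shows "cross_ratio (abs_proj1 (A *v a)) (abs_proj1 (A *v b)) (abs_proj1 (A *v c)) (abs_proj1 (A *v d)) =
    cross_ratio (abs_proj1 a) (abs_proj1 b) (abs_proj1 c) (abs_proj1 d)"
  using assms by (simp add: cross_ratio_abs invertible_mult_vec_nz bracket_matrix invertible_det_nz)

section \<open>Existence of a lift\<close>
fun iterated_product :: "(nat \<Rightarrow> 'a::field^2^2) \<Rightarrow> nat \<Rightarrow> 'a^2^2" where
  "iterated_product B 0 = mat 1"
| "iterated_product B (Suc k) = iterated_product B k ** B k"

text \<open>
  The recursion \<open>A (i + 1) = A i B i\<close> can be solved in both directions because the \<open>B i\<close> are
  invertible.  The predicate \<open>\<Phi>\<close> stands for a multiplicatively closed set of matrices containing all the
  factors, such as the invertible matrices that are regular and equal to the identity at \<open>t = 1\<close>.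
\<close>
lemma two_sided_products:
  fixes B C :: "int \<Rightarrow> 'a::field^2^2"
  assumes CB: "\<And>i. C i ** B i = mat 1"
    and \<Phi>: "\<Phi> (mat 1)" "\<And>A D. \<Phi> A \<Longrightarrow> \<Phi> D \<Longrightarrow> \<Phi> (A ** D)" "\<And>i. \<Phi> (B i)" "\<And>i. \<Phi> (C i)"
  obtains A where "A 0 = mat 1" "\<And>i. A (i + 1) = A i ** B i" "\<And>i. \<Phi> (A i)"
proof -
  define F G where "F = iterated_product (\<lambda>k. B (int k))"
    and "G = iterated_product (\<lambda>k. C (- int k - 1))"
  define A where "A = (\<lambda>i. if 0 \<le> i then F (nat i) else G (nat (- i)))"
  show thesis
  proof (rule that[of A])
    show "A 0 = mat 1" by (simp add: A_def F_def)
    show "A (i + 1) = A i ** B i" for i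
    proof (cases "0 \<le> i")
      case True
      then have "nat (i + 1) = Suc (nat i)" by simp
      with True show ?thesis by (simp add: A_def F_def)
    next
      case False
      define k where "k = nat (- i - 1)"
      have i: "i = - int k - 1" using False by (simp add: k_def)
      have "G (Suc k) ** B i = G k"
        by (simp add: i G_def CB matrix_mul_assoc[symmetric])
      moreover have "A i = G (Suc k)" using i by (auto simp: A_def nat_add_distrib)
      moreover have "A (i + 1) = G k" using i by (cases k) (auto simp: A_def F_def G_def nat_add_distrib)
      ultimately show ?thesis by simp
    qed
    have "\<Phi> (F k)" "\<Phi> (G k)" for k
      unfolding F_def G_def by (induction k) (simp_all add: \<Phi>)
    then show "\<Phi> (A i)" for i by (simp add: A_def)
  qed
qed

text \<open>
  This is the condition on a matrix representing \<open>M(t)\<close> under which its derivative at \<open>1\<close>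
  represents the tangent vector \<open>M'(1)\<close>.
\<close>
definition near_id :: "'a::field poly fract^2^2 \<Rightarrow> bool" where
  "near_id A \<longleftrightarrow> regular_matrix_at 1 A \<and> (\<chi> i j. val_at 1 (A $ i $ j)) = mat 1"

lemma near_id_entries:
  "near_id A \<longleftrightarrow> (\<forall>i j. regular_at 1 (A $ i $ j) \<and> val_at 1 (A $ i $ j) = mat 1 $ i $ j)"
  by (auto simp: near_id_def regular_matrix_at_def vec_eq_iff)

lemma near_id_mat_1: "near_id (mat 1)"
  by (simp add: near_id_entries mat_def)

lemma near_id_mult: "near_id A \<Longrightarrow> near_id B \<Longrightarrow> near_id (A ** B)"
  by (simp add: near_id_entries forall_2 matrix_matrix_mult_def sum_2 mat_def)

lemma tconst_diff: "tconst x - tconst y = tconst (x - y)"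
  by (simp add: tconst_def)

lemma tconst_inj [simp]: "tconst x = tconst y \<longleftrightarrow> x = y"
  by (metis at_tconst(2))

lemma tconst_eq_0_iff [simp]: "tconst x = 0 \<longleftrightarrow> x = 0"
  by (metis tconst_0 tconst_inj)

lemma tconst_divide: "tconst x / tconst y = tconst (x / y)"
  by (cases "y = 0") (simp_all add: tconst_def Zero_fract_def eq_fract)

lemma near_id_dilation:
  assumes "regular_at 1 u" "val_at 1 u = 1" "x \<noteq> y"
  shows "near_id (dilation u (tconst x) (tconst y))"
  using assms by (simp add: near_id_entries forall_2 dilation_nth mat_def del: divide_minus_left)

lemma closed_ngon_affine:
  assumes "closed_ngon n P" "\<And>i. vertex P i = affine_pt (p i)"
  shows "p (i + int n) = p i" "p i \<noteq> p (i + 1)" "p i \<noteq> p (i + 2)"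
proof -
  have *: "vertex P (i + int n) = pgl_apply pgl_id (vertex P i)"
    "vertex P i \<noteq> vertex P (i + 1)" "vertex P i \<noteq> vertex P (i + 2)"
    using assms(1) unfolding closed_ngon_def ngon_def by auto
  then show "p (i + int n) = p i" "p i \<noteq> p (i + 1)" "p i \<noteq> p (i + 2)"
    by (simp_all add: assms(2))
qed

lemma cr_coord_affine:
  assumes "\<And>i. vertex P i = affine_pt (p i)"
  shows "cr_coord P i = (p (int i) - p (int i - 1)) / (p (int i) - p (int i + 2)) *
    ((p (int i + 1) - p (int i + 2)) / (p (int i + 1) - p (int i - 1)))"
  by (simp add: cr_coord_def Let_def assms cross_ratio_affine)

lemma cr_coord_nonzero:
  assumes "closed_ngon n P" "\<And>i. vertex P i = affine_pt (p i)"
  shows "cr_coord P i \<noteq> 0"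
proof -
  note d = closed_ngon_affine[OF assms]
  show ?thesis
    using d(2)[of "int i - 1"] d(2)[of "int i + 1"] d(3)[of "int i"] d(3)[of "int i - 1"]
    by (simp add: cr_coord_affine[OF assms(2)] add.commute)
qed

lemma proj_specializes_near:
  assumes A: "near_id A" "invertible A"
  shows "proj_specializes 1 (abs_proj1 (A *v affine_vec (tconst x))) (affine_pt x)"
proof -
  define v where "v = A *v affine_vec (tconst x)"
  have "v \<noteq> 0" using A by (simp add: v_def invertible_mult_vec_nz)
  have "regular_at 1 (v $ 1)" "val_at 1 (v $ 1) = x" "regular_at 1 (v $ 2)" "val_at 1 (v $ 2) = 1"
    using A(1) by (simp_all add: near_id_entries forall_2 v_def matrix_vector_mult_def sum_2 mat_def)
  moreover have "vector [v $ 1, v $ 2] = v" by (simp add: vec_eq_iff forall_2)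
  ultimately show ?thesis
    unfolding proj_specializes_def has_coords_iff affine_pt_abs affine_vec_def[symmetric] v_def[symmetric]
    using \<open>v \<noteq> 0\<close> by (intro exI[of _ "v $ 1"] exI[of _ "v $ 2"]) (simp flip: affine_vec_def)
qed

lemma pgl_specializes_near:
  assumes "near_id A" "invertible A"
  shows "pgl_specializes 1 (abs_pgl2 A) pgl_id"
proof -
  have "invertible (mat 1 :: 'a^2^2)" by (auto simp: invertible_def intro!: exI[of _ "mat 1"])
  with assms show ?thesis
    unfolding pgl_specializes_def
    by (intro exI[of _ A] conjI) (simp_all add: near_id_def has_matrix_iff pgl_id.abs_eq)
qed

text \<open>
  Let \<open>u\<^sub>i = c\<^sub>i(t) / c\<^sub>i(1)\<close>, and let \<open>B\<^sub>i\<close> be the map with eigenvalue \<open>u\<^sub>i\<close> at \<open>p\<^sub>i\<close> and \<open>1\<close> at \<open>p\<^sub>i\<^sub>+\<^sub>1\<close>.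
  Solve \<open>A\<^sub>i\<^sub>+\<^sub>1 = A\<^sub>i B\<^sub>i\<close> with \<open>A\<^sub>0 = 1\<close> and put \<open>q\<^sub>i = A\<^sub>i p\<^sub>i\<close>.  As \<open>B\<^sub>i\<close> fixes \<open>p\<^sub>i\<close> and \<open>p\<^sub>i\<^sub>+\<^sub>1\<close>, the frame \<open>A\<^sub>i\<close>
  carries the whole triple \<open>p\<^sub>i\<^sub>-\<^sub>1, p\<^sub>i, p\<^sub>i\<^sub>+\<^sub>1\<close> to \<open>q\<^sub>i\<^sub>-\<^sub>1, q\<^sub>i, q\<^sub>i\<^sub>+\<^sub>1\<close>, while \<open>q\<^sub>i\<^sub>+\<^sub>2 = A\<^sub>i (B\<^sub>i p\<^sub>i\<^sub>+\<^sub>2)\<close>.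
  Therefore consecutive vertices are distinct and the \<open>i\<close>-th cross-ratio is \<open>u\<^sub>i c\<^sub>i(1) = c\<^sub>i(t)\<close>.
  Periodicity of the \<open>B\<^sub>i\<close> gives \<open>A\<^sub>i\<^sub>+\<^sub>n = A\<^sub>n A\<^sub>i\<close>, so the monodromy is \<open>A\<^sub>n\<close>.
\<close>
lemma closed_ngon_lift:
  fixes P :: "'a::field polygon"
  assumes gm: "gm_action n \<rho>" and closed: "closed_ngon n P"
    and aff: "\<And>i. vertex P i = affine_pt (p i)"
  obtains Pt A where "is_lift n \<rho> P Pt" "near_id A" "has_matrix (monodromy Pt) A"
proof -
  note per = closed_ngon_affine(1)[OF closed aff]
  note neq = closed_ngon_affine(2)[OF closed aff] closed_ngon_affine(3)[OF closed aff]
  have n: "n \<ge> 1" using closed by (simp add: closed_ngon_def ngon_def)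
  \<comment> \<open>The deformed coordinates are given only at \<open>1, \<dots>, n\<close>; \<open>k i\<close> is the index there congruent to \<open>i\<close>.\<close>
  define k where "k = (\<lambda>i. Suc (nat ((i - 1) mod int n)))"
  have k: "k i \<in> {1..n}" for i
    using n by (simp add: k_def Suc_le_eq nat_less_iff)
  have k_self: "k (int i) = i" if "i \<in> {1..n}" for i
  proof -
    have "(int i - 1) mod int n = int i - 1"
      using that by (intro mod_pos_pos_trivial) auto
    then have "k (int i) = Suc (nat (int i - 1))" by (simp add: k_def)
    then show ?thesis using that unfolding atLeastAtMost_iff by arith
  qed
  have k_per: "k (i + int n) = k i" for i
  proof -
    have "i + int n - 1 = (i - 1) + int n" by simp
    then have "(i + int n - 1) mod int n = (i - 1) mod int n" by (simp only: mod_add_self2)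
    then show ?thesis by (simp add: k_def)
  qed
  define c where "c = deformed_coord n \<rho> P"
  define u where "u = (\<lambda>i. c (k i) / tconst (cr_coord P (k i)))"
  note cr_nz = cr_coord_nonzero[OF closed aff]
  have c: "regular_at 1 (c i)" "val_at 1 (c i) = cr_coord P i" if "i \<in> {1..n}" for i
    using deformed_coord_at_1[OF gm cr_nz that] by (simp_all add: c_def)
  have u: "regular_at 1 (u i)" "val_at 1 (u i) = 1" for i
    using c[OF k] cr_nz by (simp_all add: u_def)
  then have u_nz: "u i \<noteq> 0" for i by (metis at_0(2) zero_neq_one)
  have inv_u: "regular_at 1 (inverse (u i))" "val_at 1 (inverse (u i)) = 1" for i
    using u by (simp_all add: inverse_eq_divide)
  define v where "v = (\<lambda>i. affine_vec (tconst (p i)))"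
  define B where "B = (\<lambda>i. dilation (u i) (tconst (p i)) (tconst (p (i + 1))))"
  define C where "C = (\<lambda>i. dilation (inverse (u i)) (tconst (p i)) (tconst (p (i + 1))))"
  have C_B: "C i ** B i = mat 1" for i
    using dilation_inverse[of "tconst (p i)" "tconst (p (i + 1))" "inverse (u i)"] neq u_nz
    by (simp add: B_def C_def)
  obtain A where A_0: "A 0 = mat 1" and A_Suc: "\<And>i. A (i + 1) = A i ** B i"
    and A: "\<And>i. near_id (A i) \<and> invertible (A i)"
  proof (rule two_sided_products[of C B "\<lambda>A. near_id A \<and> invertible A"])
    show "near_id (mat 1) \<and> invertible (mat 1 :: 'a poly fract^2^2)"
      using near_id_mat_1 by (auto simp: invertible_def intro!: exI[of _ "mat 1"])
    show "near_id (B i) \<and> invertible (B i)" "near_id (C i) \<and> invertible (C i)" for i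
      using u u_nz inv_u neq by (simp_all add: B_def C_def near_id_dilation invertible_det_nz det_dilation)
  qed (use C_B in \<open>auto simp: near_id_mult invertible_mult\<close>)
  have nz: "A i *v v j \<noteq> 0" for i j
    using A by (simp add: v_def invertible_mult_vec_nz)
  have A_per: "A (i + int n) = A (int n) ** A i" for i
  proof (induction i rule: int_induct[where k = 0])
    case base
    then show ?case by (simp add: A_0)
  next
    case (step1 i)
    have "B (i + int n) = B i" using per[of i] per[of "i + 1"] by (simp add: B_def u_def k_per ac_simps)
    then show ?case using step1 A_Suc[of "i + int n"] A_Suc[of i] 
      by (simp add: ac_simps matrix_mul_assoc)
  next
    case (step2 i)
    have A_pred: "A j = A (j + 1) ** C j" for j
      using matrix_left_right_inverse[of "C j" "B j"] C_B 
      by (simp add: A_Suc flip: matrix_mul_assoc)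
    have "C (i - 1 + int n) = C (i - 1)"
      using per[of i] per[of "i - 1"] k_per[of "i - 1"] by (simp add: C_def u_def ac_simps)
    then show ?case using step2 A_pred[of "i - 1 + int n"] A_pred[of "i - 1"]
      by (simp add: ac_simps matrix_mul_assoc)
  qed
  define q where "q = (\<lambda>i. abs_proj1 (A i *v v i))"
  have A_step: "A (i + 1) *v w = A i *v (B i *v w)" for i w
    by (simp add: A_Suc flip: matrix_vector_mul_assoc)
  have B_v: "B i *v v i = u i *s v i" "B i *v v (i + 1) = v (i + 1)" for i
    using neq by (simp_all add: B_def v_def dilation_fst dilation_snd)
  have q_next: "q (i + 1) = abs_proj1 (A i *v v (i + 1))" for i
    by (simp only: q_def A_step B_v)
  have q_prev: "q i = abs_proj1 (A (i + 1) *v v i)" for i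
    by (simp only: q_def A_step B_v vector_scalar_commute abs_proj1_scale[OF nz u_nz])
  have q_last: "q (i + 2) = abs_proj1 (A i *v (B i *v v (i + 2)))" for i
  proof -
    have "i + 2 = i + 1 + 1" by simp
    then show ?thesis using q_next[of "i + 1"] by (simp only: A_step)
  qed
  have distinct: "abs_proj1 (A i *v v j) \<noteq> abs_proj1 (A i *v v l)" if "p j \<noteq> p l" for i j l
    using that A nz by (simp add: abs_proj1_eq_iff bracket_matrix invertible_det_nz)
      (simp add: v_def bracket_def)
  define Pt where "Pt = \<lparr>vertex = q, monodromy = abs_pgl2 (A (int n))\<rparr>"
  have cr: "cr_coord Pt i = deformed_coord n \<rho> P i" if i: "i \<in> {1..n}" for i
  proof -
    define j where "j = int i"
    let ?B = "B j *v v (j + 2)"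
    have B_nz: "?B \<noteq> 0"
      using neq u_nz by (simp add: B_def v_def invertible_mult_vec_nz invertible_det_nz det_dilation)
    have "cr_coord Pt i = cross_ratio (q (j - 1)) (q j) (q (j + 1)) (q (j + 2))"
      by (simp add: cr_coord_def Pt_def Let_def j_def)
    also have "\<dots> = cross_ratio (abs_proj1 (v (j - 1))) (abs_proj1 (v j)) (abs_proj1 (v (j + 1))) (abs_proj1 ?B)"
      using q_prev[of "j - 1"] q_next[of j] q_last[of j] A B_nz
      by (simp add: q_def cross_ratio_matrix v_def)
    also have "\<dots> = u j * cross_ratio (affine_pt (tconst (p (j - 1)))) (affine_pt (tconst (p j)))
        (affine_pt (tconst (p (j + 1)))) (affine_pt (tconst (p (j + 2))))"
      using cross_ratio_dilation[of "tconst (p j)" "tconst (p (j + 1))" "u j"] neq u_nz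
      by (simp add: v_def B_def flip: affine_pt_abs)
    also have "\<dots> = u j * tconst (cr_coord P i)"
      by (simp only: cross_ratio_affine cr_coord_affine[OF aff] j_def tconst_diff tconst_divide
          flip: tconst.hom_mult)
    also have "\<dots> = c i"
      using i by (simp add: u_def j_def k_self cr_nz)
    finally show ?thesis by (simp add: c_def)
  qed
  have "ngon n Pt"
    unfolding ngon_def
  proof (intro conjI allI n)
    fix i
    have "q (i + int n) = abs_proj1 (A (int n) *v (A i *v v i))"
      by (simp only: q_def A_per v_def per matrix_vector_mul_assoc)
    also have "\<dots> = pgl_apply (abs_pgl2 (A (int n))) (q i)"
      using pgl_apply_abs[OF conjunct2[OF A] nz] by (simp only: q_def)
    finally show "vertex Pt (i + int n) = pgl_apply (monodromy Pt) (vertex Pt i)"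
      by (simp add: Pt_def)
    have two: "i + 2 = i + 1 + 1" by simp
    have "p i \<noteq> p (i + 1)" "p (i + 1) \<noteq> p (i + 1 + 1)" "p i \<noteq> p (i + 1 + 1)"
      using neq[of i] neq(1)[of "i + 1"] unfolding two by blast+
    from this[THEN distinct[where i = "i + 1"]]
    have "q i \<noteq> q (i + 1)" "q (i + 1) \<noteq> q (i + 1 + 1)" "q i \<noteq> q (i + 1 + 1)"
      unfolding q_prev[of i] q_next[of "i + 1"] unfolding q_def .
    then show "vertex Pt i \<noteq> vertex Pt (i + 1)" "vertex Pt (i + 1) \<noteq> vertex Pt (i + 2)"
      "vertex Pt i \<noteq> vertex Pt (i + 2)"
      unfolding Pt_def polygon.select_convs two .
  qed
  moreover have "proj_specializes 1 (vertex Pt i) (vertex P i)" for i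
    using A by (simp add: Pt_def q_def v_def aff proj_specializes_near)
  moreover have "pgl_specializes 1 (monodromy Pt) (monodromy P)"
    using A closed by (simp add: Pt_def closed_ngon_def pgl_specializes_near)
  ultimately have "is_lift n \<rho> P Pt" unfolding is_lift_def using cr by blast
  then show thesis
    using that[of Pt "A (int n)"] A by (simp add: Pt_def has_matrix_iff)
qed

section \<open>Quadratic vector fields on the line\<close>
text \<open>
  The fields \<open>(\<alpha> + \<beta> x + \<gamma> x\<^sup>2) d/dx\<close> are the infinitesimal projective transformations of the line.
\<close>
definition quadratic :: "('a::field \<Rightarrow> 'a) \<Rightarrow> bool" where
  "quadratic f \<longleftrightarrow> (\<exists>\<alpha> \<beta> \<gamma>. \<forall>x. f x = \<alpha> + \<beta> * x + \<gamma> * x\<^sup>2)"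

lemma quadratic_add: "quadratic f \<Longrightarrow> quadratic g \<Longrightarrow> quadratic (\<lambda>x. f x + g x)"
proof -
  assume "quadratic f" "quadratic g"
  then obtain \<alpha> \<beta> \<gamma> \<alpha>' \<beta>' \<gamma>' where "\<And>x. f x = \<alpha> + \<beta> * x + \<gamma> * x\<^sup>2"
    "\<And>x. g x = \<alpha>' + \<beta>' * x + \<gamma>' * x\<^sup>2" unfolding quadratic_def by metis
  then have "\<forall>x. f x + g x = (\<alpha> + \<alpha>') + (\<beta> + \<beta>') * x + (\<gamma> + \<gamma>') * x\<^sup>2"
    by (simp add: algebra_simps)
  then show ?thesis unfolding quadratic_def by blast
qed

lemma quadratic_sum: "(\<And>i. i \<in> S \<Longrightarrow> quadratic (f i)) \<Longrightarrow> quadratic (\<lambda>x. \<Sum>i\<in>S. f i x)"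
proof (induction S rule: infinite_finite_induct)
  case (insert i S)
  then show ?case by (simp add: quadratic_add)
qed (auto simp: quadratic_def intro!: exI[of _ 0])

lemma quadratic_product: "quadratic (\<lambda>x. k * ((x - a) * (x - b)))"
proof -
  have "\<forall>x. k * ((x - a) * (x - b)) = k * (a * b) + (- k * (a + b)) * x + k * x\<^sup>2"
    by (simp add: algebra_simps power2_eq_square)
  then show ?thesis unfolding quadratic_def by blast
qed

lemma quadratic_interpolation:
  assumes "a \<noteq> b" "b \<noteq> c" "a \<noteq> c"
  obtains f where "quadratic f" "f a = y" "f b = z" "f c = (w :: 'a::field)"
proof -
  define d where "d = (z - y) / (b - a)"
  define e where "e = (w - y - d * (c - a)) / ((c - a) * (c - b))"
  define f where "f = (\<lambda>x. (y + d * (x - a)) + e * ((x - a) * (x - b)))"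
  have "\<forall>x. y + d * (x - a) = (y - d * a) + d * x + 0 * x\<^sup>2" by (simp add: algebra_simps)
  then have "quadratic (\<lambda>x. y + d * (x - a))" unfolding quadratic_def by blast
  then have "quadratic f" unfolding f_def by (rule quadratic_add) (rule quadratic_product)
  moreover have "f a = y" "f b = z" "f c = w"
    using assms by (simp_all add: f_def d_def e_def)
  ultimately show thesis by (rule that)
qed

lemma quadratic_eq_0:
  fixes \<alpha> \<beta> \<gamma> :: "'a::field"
  assumes "a \<noteq> b" "b \<noteq> c" "a \<noteq> c"
    and z: "\<And>x. x \<in> {a, b, c} \<Longrightarrow> \<alpha> + \<beta> * x + \<gamma> * x\<^sup>2 = 0"
  shows "\<alpha> = 0" "\<beta> = 0" "\<gamma> = 0"
proof -
  have *: "\<alpha> + \<beta> * a + \<gamma> * a\<^sup>2 = 0" "\<alpha> + \<beta> * b + \<gamma> * b\<^sup>2 = 0" "\<alpha> + \<beta> * c + \<gamma> * c\<^sup>2 = 0"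
    by (auto intro: z)
  have "(a - b) * (\<beta> + \<gamma> * (a + b)) = 0" "(a - c) * (\<beta> + \<gamma> * (a + c)) = 0"
    using * by algebra+
  then have **: "\<beta> + \<gamma> * (a + b) = 0" "\<beta> + \<gamma> * (a + c) = 0" using assms by simp_all
  then have "(b - c) * \<gamma> = 0" by algebra
  then show "\<gamma> = 0" using assms by simp
  then show "\<beta> = 0" using ** by simp
  then show "\<alpha> = 0" using * \<open>\<gamma> = 0\<close> by simp
qed

text \<open>
  Cross-ratios are projectively invariant, so velocities given by a quadratic field \<open>f\<close> do not change
  \<open>r\<close> to first order.  Hence only the excess \<open>d' - f d\<close> of the velocity of the fourth point
  contributes to \<open>r'\<close>, linearly, and the logarithmic derivative \<open>w = r' / r\<close> determines it.  The
  hypotheses are the defining equation of \<open>r\<close>, cleared of denominators, and its derivative.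
\<close>
lemma cross_ratio_variation:
  fixes a b c d :: "'a::field"
  assumes f: "quadratic f" and neq: "a \<noteq> b" "a \<noteq> c" "b \<noteq> c" "b \<noteq> d"
    and r: "r * ((b - d) * (c - a)) = (b - a) * (c - d)"
    and r': "w * r * ((b - d) * (c - a)) + r * ((f b - d') * (c - a) + (b - d) * (f c - f a)) =
      (f b - f a) * (c - d) + (b - a) * (f c - d')"
  shows "d' = f d + - w / (b - c) * ((d - b) * (d - c))"
proof -
  obtain \<alpha> \<beta> \<gamma> where fx: "\<And>x. f x = \<alpha> + \<beta> * x + \<gamma> * x\<^sup>2"
    using f unfolding quadratic_def by blast
  define e where "e = d' - f d"
  have d': "d' = e + f d" by (simp add: e_def)
  have "(b - a) * (c - a) * (e * (c - b)) = (b - a) * (c - a) * (w * ((c - d) * (b - d)))"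
    using r r' unfolding d' fx by algebra
  then have "e * (c - b) = w * ((c - d) * (b - d))" using neq by simp
  then have "e = - w / (b - c) * ((d - b) * (d - c))" using neq by (simp add: field_simps)
  then show ?thesis by (simp add: d')
qed

text \<open>
  Suppose that a quadratic field \<open>g\<close> gives the velocities of the three vertices \<open>p\<^sub>k, p\<^sub>k\<^sub>+\<^sub>1, p\<^sub>k\<^sub>+\<^sub>2\<close>.  By
  the variation of the cross-ratio, adding the field
  \<open>- w\<^sub>i (x - p\<^sub>i) (x - p\<^sub>i\<^sub>+\<^sub>1) / (p\<^sub>i - p\<^sub>i\<^sub>+\<^sub>1)\<close> with \<open>i = k + 1\<close> corrects \<open>g\<close> at \<open>p\<^sub>k\<^sub>+\<^sub>3\<close>, and since this field
  vanishes at \<open>p\<^sub>k\<^sub>+\<^sub>1\<close> and \<open>p\<^sub>k\<^sub>+\<^sub>2\<close> the sum is right for the next triple.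
\<close>
lemma sum_vertex_fields:
  fixes p y :: "int \<Rightarrow> 'a::field" and w r :: "nat \<Rightarrow> 'a"
  assumes neq: "\<And>i. p i \<noteq> p (i + 1)" "\<And>i. p i \<noteq> p (i + 2)"
    and f: "quadratic f" "\<And>j. j \<in> {0, 1, 2} \<Longrightarrow> y j = f (p j)"
    and r: "\<And>i. i \<in> {1..n} \<Longrightarrow>
      r i * ((p (int i) - p (int i + 2)) * (p (int i + 1) - p (int i - 1))) =
      (p (int i) - p (int i - 1)) * (p (int i + 1) - p (int i + 2))"
    and r': "\<And>i. i \<in> {1..n} \<Longrightarrow>
      w i * r i * ((p (int i) - p (int i + 2)) * (p (int i + 1) - p (int i - 1))) +
      r i * ((y (int i) - y (int i + 2)) * (p (int i + 1) - p (int i - 1)) +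
             (p (int i) - p (int i + 2)) * (y (int i + 1) - y (int i - 1))) =
      (y (int i) - y (int i - 1)) * (p (int i + 1) - p (int i + 2)) +
      (p (int i) - p (int i - 1)) * (y (int i + 1) - y (int i + 2))"
    and k: "k \<le> n" and j: "j \<in> {int k, int k + 1, int k + 2}"
  shows "y j = f (p j) + (\<Sum>i=1..k. - w i / (p (int i) - p (int i + 1)) *
    ((p j - p (int i)) * (p j - p (int i + 1))))"
  using k j
proof (induction k arbitrary: j)
  case 0
  then show ?case using f(2) by simp
next
  case (Suc k)
  define h where "h = (\<lambda>i x. - w i / (p (int i) - p (int i + 1)) * ((x - p (int i)) * (x - p (int i + 1))))"
  define g where "g = (\<lambda>x. f x + (\<Sum>i=1..k. h i x))"
  have g: "quadratic g"
    unfolding g_def by (intro quadratic_add quadratic_sum f) (simp only: h_def quadratic_product)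
  have y: "y j = g (p j)" if "j \<in> {int k, int k + 1, int k + 2}" for j
    using Suc.IH[OF _ that] Suc.prems(1) by (simp add: g_def h_def)
  have i: "Suc k \<in> {1..n}" using Suc.prems(1) by simp
  have s: "int (Suc k) = int k + 1" "int k + 1 + 1 = int k + 2" "int k + 1 + 2 = int k + 3" "int k + 1 - 1 = int k"
    by simp_all
  have y3: "y (int k + 3) = g (p (int k + 3)) + h (Suc k) (p (int k + 3))"
    unfolding h_def s
  proof (rule cross_ratio_variation[OF g])
    show "p (int k) \<noteq> p (int k + 1)" "p (int k) \<noteq> p (int k + 2)" by (rule neq)+
    show "p (int k + 1) \<noteq> p (int k + 2)" "p (int k + 1) \<noteq> p (int k + 3)"
      using neq(1)[of "int k + 1"] neq(2)[of "int k + 1"] unfolding s by blast+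
    show "r (Suc k) * ((p (int k + 1) - p (int k + 3)) * (p (int k + 2) - p (int k))) =
        (p (int k + 1) - p (int k)) * (p (int k + 2) - p (int k + 3))"
      using r[OF i] by (simp only: s)
    show "w (Suc k) * r (Suc k) * ((p (int k + 1) - p (int k + 3)) * (p (int k + 2) - p (int k))) +
      r (Suc k) * ((g (p (int k + 1)) - y (int k + 3)) * (p (int k + 2) - p (int k)) +
             (p (int k + 1) - p (int k + 3)) * (g (p (int k + 2)) - g (p (int k)))) =
      (g (p (int k + 1)) - g (p (int k))) * (p (int k + 2) - p (int k + 3)) +
      (p (int k + 1) - p (int k)) * (g (p (int k + 2)) - y (int k + 3))"
      using r'[OF i] by (simp only: s) (simp add: y)
  qed
  have "y j = g (p j) + h (Suc k) (p j)"
  proof (cases "j = int k + 3")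
    case True
    then show ?thesis using y3 by simp
  next
    case False
    then have j: "j = int k + 1 \<or> j = int k + 2" using Suc.prems(2) by auto
    then have "h (Suc k) (p j) = 0" unfolding h_def s by auto
    then show ?thesis using y[of j] j by auto
  qed
  then show ?case by (simp add: g_def h_def)
qed

section \<open>The infinitesimal monodromy\<close>
text \<open>
  The field of the tangent vector \<open>M'(1)\<close> is \<open>a + b x - d x\<^sup>2\<close>, with \<open>a, d\<close> the off-diagonal entries
  and \<open>b\<close> the difference of the diagonal ones.  Differentiating \<open>x\<^sub>i\<^sub>+\<^sub>n(t) = M(t) x\<^sub>i(t)\<close> shows that it is
  the increment of the velocity from \<open>p\<^sub>i\<close> to \<open>p\<^sub>i\<^sub>+\<^sub>n = p\<^sub>i\<close>.  By the previous lemma so is the sum of the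
  \<open>n\<close> vertex fields, at \<open>p\<^sub>0, p\<^sub>1, p\<^sub>2\<close>; two quadratic fields that agree at three points are equal, and
  the claim is the comparison of coefficients.
\<close>
lemma monodromy_derivative:
  fixes P :: "'a::field polygon"
  assumes gm: "gm_action n \<rho>" and closed: "closed_ngon n P"
    and aff: "\<And>i. vertex P i = affine_pt (p i)"
    and lift: "is_lift n \<rho> P Pt" and A: "near_id A" "has_matrix (monodromy Pt) A"
    and w: "\<And>i. w i = deriv_at 1 (deformed_coord n \<rho> P i) / val_at 1 (deformed_coord n \<rho> P i)"
  shows "deriv_at 1 (A $ 2 $ 1) = (\<Sum>i=1..n. w i * (1 / (p (int i) - p (int i + 1))))"
    "deriv_at 1 (A $ 1 $ 1) - deriv_at 1 (A $ 2 $ 2) =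
      (\<Sum>i=1..n. w i * ((p (int i) + p (int i + 1)) / (p (int i) - p (int i + 1))))"
    "deriv_at 1 (A $ 1 $ 2) = - (\<Sum>i=1..n. w i * (p (int i) * p (int i + 1) / (p (int i) - p (int i + 1))))"
proof -
  note per = closed_ngon_affine(1)[OF closed aff]
  note neq = closed_ngon_affine(2)[OF closed aff] closed_ngon_affine(3)[OF closed aff]
  have "\<exists>f. vertex Pt i = affine_pt f \<and> regular_at 1 f \<and> val_at 1 f = p i" for i
  proof -
    have "proj_specializes 1 (vertex Pt i) (affine_pt (p i))"
      using lift by (simp add: is_lift_def flip: aff)
    then show ?thesis using proj_specializes_affine by blast
  qed
  then obtain x where x: "\<And>i. vertex Pt i = affine_pt (x i)" "\<And>i. regular_at 1 (x i)"
    "\<And>i. val_at 1 (x i) = p i" by metis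
  define y where "y = (\<lambda>i. deriv_at 1 (x i))"
  define c where "c = deformed_coord n \<rho> P"
  note cr_nz = cr_coord_nonzero[OF closed aff]
  have c: "regular_at 1 (c i)" "val_at 1 (c i) = cr_coord P i" if "i \<in> {1..n}" for i
    using deformed_coord_at_1[OF gm cr_nz that] by (simp_all add: c_def)
  have x_neq: "x i \<noteq> x j" if "p i \<noteq> p j" for i j using that x(3) by metis
  have neq': "p i \<noteq> p (i + 2)" "p (i + 1) \<noteq> p (i - 1)" for i
    using neq(2)[of i] neq(2)[of "i - 1"] by (simp_all add: add.commute)
  have cr: "c i * ((x (int i) - x (int i + 2)) * (x (int i + 1) - x (int i - 1))) =
      (x (int i) - x (int i - 1)) * (x (int i + 1) - x (int i + 2))" if "i \<in> {1..n}" for i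
  proof -
    have "cr_coord Pt i = c i" using lift that by (simp add: is_lift_def c_def)
    then have "c i = (x (int i) - x (int i - 1)) / (x (int i) - x (int i + 2)) *
        ((x (int i + 1) - x (int i + 2)) / (x (int i + 1) - x (int i - 1)))"
      using cr_coord_affine[of Pt x i] x(1) by simp
    then show ?thesis
      using neq'[THEN x_neq, of "int i"] by simp
  qed
  have r: "cr_coord P i * ((p (int i) - p (int i + 2)) * (p (int i + 1) - p (int i - 1))) =
      (p (int i) - p (int i - 1)) * (p (int i + 1) - p (int i + 2))" if "i \<in> {1..n}" for i
    using arg_cong[OF cr[OF that], of "val_at 1"] c[OF that] x by simp
  have r': "w i * cr_coord P i * ((p (int i) - p (int i + 2)) * (p (int i + 1) - p (int i - 1))) +
      cr_coord P i * ((y (int i) - y (int i + 2)) * (p (int i + 1) - p (int i - 1)) +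
             (p (int i) - p (int i + 2)) * (y (int i + 1) - y (int i - 1))) =
      (y (int i) - y (int i - 1)) * (p (int i + 1) - p (int i + 2)) +
      (p (int i) - p (int i - 1)) * (y (int i + 1) - y (int i + 2))" if "i \<in> {1..n}" for i
  proof -
    have "w i * cr_coord P i = deriv_at 1 (c i)"
      using c[OF that] cr_nz by (simp add: w flip: c_def)
    then show ?thesis
      using arg_cong[OF cr[OF that], of "deriv_at 1"] c[OF that] x by (simp add: y_def)
  qed
  have "p 0 \<noteq> p 1" "p 1 \<noteq> p 2" "p 0 \<noteq> p 2" using neq(1)[of 0] neq(1)[of 1] neq(2)[of 0] by simp_all
  note p012 = this
  \<comment> \<open>The field giving the velocities of the first triple.\<close>
  obtain f where f: "quadratic f" "f (p 0) = y 0" "f (p 1) = y 1" "f (p 2) = y 2"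
    using quadratic_interpolation[OF p012] by blast
  define a b d where "a = deriv_at 1 (A $ 1 $ 2)" and "b = deriv_at 1 (A $ 1 $ 1) - deriv_at 1 (A $ 2 $ 2)"
    and "d = deriv_at 1 (A $ 2 $ 1)"
  have mon: "y (i + int n) = y i + (a + b * p i - d * (p i)\<^sup>2)" for i
  proof -
    have "vertex Pt (i + int n) = pgl_apply (monodromy Pt) (vertex Pt i)"
      using lift by (simp add: is_lift_def ngon_def)
    then have "x (i + int n) * (A $ 2 $ 1 * x i + A $ 2 $ 2) = A $ 1 $ 1 * x i + A $ 1 $ 2"
      using pgl_apply_affine[OF A(2), of "x i" "x (i + int n)"] by (simp add: x(1))
    from arg_cong[OF this, of "deriv_at 1"] show ?thesis
      using A(1) x by (simp add: near_id_entries forall_2 mat_def y_def a_def b_def d_def per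
          algebra_simps power2_eq_square)
  qed
  \<comment> \<open>The three coefficients of the sum of the vertex fields are \<open>- S (u v)\<close>, \<open>S (u + v)\<close> and \<open>- S 1\<close>.\<close>
  define S where "S = (\<lambda>g. \<Sum>i=1..n. w i * (g (p (int i)) (p (int i + 1)) / (p (int i) - p (int i + 1))))"
  have "(a + S (\<lambda>u v. u * v)) + (b - S (\<lambda>u v. u + v)) * q + (S (\<lambda>u v. 1) - d) * q\<^sup>2 = 0"
    if "q \<in> {p 0, p 1, p 2}" for q
  proof -
    from that obtain j :: int where j: "j \<in> {0, 1, 2}" "q = p j" by blast
    have "y (j + int n) = f (p (j + int n)) + (\<Sum>i=1..n. - w i / (p (int i) - p (int i + 1)) *
        ((p (j + int n) - p (int i)) * (p (j + int n) - p (int i + 1))))"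
      by (rule sum_vertex_fields[where r = "cr_coord P", OF neq f(1) _ r r' order_refl])
        (use f j in auto)
    moreover have "f (p j) = y j" using f j by auto
    ultimately have "a + b * q - d * q\<^sup>2 = (\<Sum>i=1..n. - w i / (p (int i) - p (int i + 1)) *
        ((q - p (int i)) * (q - p (int i + 1))))"
      by (simp add: mon per j(2))
    also have "\<dots> = - S (\<lambda>u v. u * v) + S (\<lambda>u v. u + v) * q - S (\<lambda>u v. 1) * q\<^sup>2"
      unfolding S_def sum_distrib_right sum_negf[symmetric] sum.distrib[symmetric] sum_subtractf[symmetric]
    proof (rule sum.cong)
      fix i
      define s where "s = inverse (p (int i) - p (int i + 1))"
      show "- w i / (p (int i) - p (int i + 1)) * ((q - p (int i)) * (q - p (int i + 1))) =
          - (w i * (p (int i) * p (int i + 1) / (p (int i) - p (int i + 1)))) +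
          w i * ((p (int i) + p (int i + 1)) / (p (int i) - p (int i + 1))) * q -
          w i * (1 / (p (int i) - p (int i + 1))) * q\<^sup>2"
        unfolding divide_inverse s_def[symmetric] by (simp add: algebra_simps power2_eq_square)
    qed simp
    finally show ?thesis by (simp add: algebra_simps)
  qed
  from quadratic_eq_0[OF p012 this] show
    "deriv_at 1 (A $ 2 $ 1) = (\<Sum>i=1..n. w i * (1 / (p (int i) - p (int i + 1))))"
    "deriv_at 1 (A $ 1 $ 1) - deriv_at 1 (A $ 2 $ 2) =
      (\<Sum>i=1..n. w i * ((p (int i) + p (int i + 1)) / (p (int i) - p (int i + 1))))"
    "deriv_at 1 (A $ 1 $ 2) = - (\<Sum>i=1..n. w i * (p (int i) * p (int i + 1) / (p (int i) - p (int i + 1))))"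
    by (simp_all add: a_def b_def d_def S_def eq_neg_iff_add_eq_0)
qed

lemma lie_class_eq_iff: "lie_class A = lie_class B \<longleftrightarrow> (\<exists>k. A = B + mat k)"
  by (simp add: lie_class.abs_eq lie_pgl2.abs_eq_iff lie_rel_def)

theorem theorem4p2:
  fixes n :: nat and T :: "nat \<Rightarrow> 'a::field ratfun proj1" and \<rho> :: "nat \<Rightarrow> 'a ratfun"
    and P :: "'a polygon" and p :: "int \<Rightarrow> 'a" and w :: "nat \<Rightarrow> 'a" and I J K :: 'a
  assumes "(2::'a) \<noteq> 0"
    and "polygonal_transformation n T"
    and "scaling_symmetry n T \<rho>"
    and "closed_ngon n P"
    and "\<And>i. vertex P i = affine_pt (p i)"
  defines "w \<equiv> \<lambda>i. deriv_at 1 (deformed_coord n \<rho> P i) / val_at 1 (deformed_coord n \<rho> P i)"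
    and "I \<equiv> \<Sum>i=1..n. w i * (1 / (p (int i) - p (int i + 1)))"
    and "J \<equiv> 1 / 2 * (\<Sum>i=1..n. w i * ((p (int i) + p (int i + 1)) / (p (int i) - p (int i + 1))))"
    and "K \<equiv> \<Sum>i=1..n. w i * (p (int i) * p (int i + 1) / (p (int i) - p (int i + 1)))"
  shows "infinitesimal_monodromy n \<rho> P =
           lie_class (mat (of_nat n / 2) + vector [vector [J, - K], vector [I, - J]]) \<and>
         (\<forall>X Y. lie_eigenvector (infinitesimal_monodromy n \<rho> P) (vector [X, Y]) \<longrightarrow>
            I * X\<^sup>2 - 2 * J * X * Y + K * Y\<^sup>2 = 0)"
proof -
  let ?L = "mat (of_nat n / 2) + vector [vector [J, - K], vector [I, - J]] :: 'a^2^2"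
  have gm: "gm_action n \<rho>" using assms(3) by (simp add: scaling_symmetry_def)
  have tangent: "lie_class (\<chi> i j. deriv_at 1 (A $ i $ j)) = lie_class ?L"
    if "is_lift n \<rho> P Pt" "near_id A" "has_matrix (monodromy Pt) A" for Pt A
  proof -
    note D = monodromy_derivative[OF gm assms(4,5) that, of w]
    have "deriv_at 1 (A $ 2 $ 1) = I" "deriv_at 1 (A $ 1 $ 2) = - K"
      "deriv_at 1 (A $ 1 $ 1) - deriv_at 1 (A $ 2 $ 2) = 2 * J"
      using D assms(1) unfolding I_def J_def K_def by (simp_all add: w_def)
    then show ?thesis
      unfolding lie_class_eq_iff using assms(1)
      \<comment> \<open>The scalar is read off the upper left entry; the lower right one then agrees, as on both sides it is smaller by \<open>2 J\<close>.\<close>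
      by (intro exI[of _ "deriv_at 1 (A $ 1 $ 1) - J - of_nat n / 2"])
        (simp add: vec_eq_iff forall_2 mat_def algebra_simps)
  qed
  obtain Pt A where lift: "is_lift n \<rho> P Pt" "near_id A" "has_matrix (monodromy Pt) A"
    using closed_ngon_lift[OF gm assms(4,5)] .
  \<comment> \<open>Existence comes from one lift; uniqueness from \<open>tangent\<close>, which holds for all of them.\<close>
  have eq: "infinitesimal_monodromy n \<rho> P = lie_class ?L"
    unfolding infinitesimal_monodromy_def
  proof (rule the_equality)
    have "tangent_at_id (monodromy Pt) (lie_class ?L)"
      unfolding tangent_at_id_def using lift tangent[OF lift] by (auto simp: near_id_def)
    then show "\<exists>Pt. is_lift n \<rho> P Pt \<and> tangent_at_id (monodromy Pt) (lie_class ?L)"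
      using lift by blast
  next
    fix X assume "\<exists>Pt. is_lift n \<rho> P Pt \<and> tangent_at_id (monodromy Pt) X"
    then show "X = lie_class ?L"
      unfolding tangent_at_id_def using tangent by (auto simp: near_id_def)
  qed
  moreover have "I * X\<^sup>2 - 2 * J * X * Y + K * Y\<^sup>2 = 0"
    if "lie_eigenvector (lie_class ?L) (vector [X, Y])" for X Y
  proof -
    from that obtain l where "?L *v vector [X, Y] = l *s vector [X, Y]"
      by (auto simp: lie_class.abs_eq lie_eigenvector.abs_eq)
    then have "(of_nat n / 2 + J) * X - K * Y = l * X" "I * X + (of_nat n / 2 - J) * Y = l * Y"
      by (simp_all add: vec_eq_iff forall_2 matrix_vector_mult_def sum_2 mat_def)
    \<comment> \<open>Eliminate the eigenvalue: \<open>X\<close> times the second equation minus \<open>Y\<close> times the first.\<close>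
    then show ?thesis by algebra
  qed
  ultimately show ?thesis by simp
qed

end
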